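(* Let $0<\alpha<1$ and let $p:\mathbb{R}\to\mathbb{R}$ be Lipschitz-continuous, $2\pi$-periodic, with $p(t)<0$ for all $t$. Then there exists $m_1\in\mathbb{N}$ such that for every integer $m\ge m_1$ the equation $\ddot u-\frac{1}{u^\alpha}=p(t)$ has at least two $2m\pi$-periodic bouncing solutions having exactly one impact (zero) in the interval $[0,2m\pi)$.
   Context: A bouncing solution of $\ddot u-\frac{1}{u^\alpha}=p(t)$ is a continuous function $u:\mathbb{R}\to[0,+\infty)$ such that: (a) its zero set $Z=\{t: u(t)=0\}$ is discrete; (b) on every open interval $J\subset\mathbb{R}\setminus Z$, $u\in C^2(J)$ and satisfies the equation; (c) at each $t_*\in Z$ the one-sided limits $\dot u(t_*^+)$ and $\dot u(t_*^-)$ exist and $\dot u(t_*^+)=-\dot u(t_*^-)$. Zeros of $u$ are called impacts. A solution is $2m\pi$-periodic if $u(t+2m\pi)=u(t)$ for all $t$. *)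

theory Defs
  imports "HOL-Analysis.Analysis"
begin

definition zero_set :: "(real \<Rightarrow> real) \<Rightarrow> real set" where
  "zero_set u = {t. u t = 0}"

definition bouncing_solution :: "real \<Rightarrow> (real \<Rightarrow> real) \<Rightarrow> (real \<Rightarrow> real) \<Rightarrow> bool" where
  "bouncing_solution \<alpha> p u \<longleftrightarrow>
     continuous_on UNIV u \<and> (\<forall>t. u t \<ge> 0) \<and>
     \<comment> \<open>(a) the zero set is discrete\<close>
     (\<forall>t\<in>zero_set u. \<exists>e>0. \<forall>s\<in>zero_set u. \<bar>s - t\<bar> < e \<longrightarrow> s = t) \<and>
     \<comment> \<open>(b) C^2 and solves the equation on every open interval avoiding zeros\<close>
     (\<forall>a b. {a<..<b} \<inter> zero_set u = {} \<longrightarrow>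
        (\<exists>u' u''. (\<forall>t\<in>{a<..<b}. (u has_real_derivative u' t) (at t) \<and>
                                 (u' has_real_derivative u'' t) (at t) \<and>
                                 u'' t - 1 / (u t powr \<alpha>) = p t) \<and>
                   continuous_on {a<..<b} u'')) \<and>
     \<comment> \<open>(c) elastic bounce condition at each impact\<close>
     (\<forall>t\<in>zero_set u. \<exists>v.
        ((\<lambda>s. deriv u s) \<longlongrightarrow> v) (at_right t) \<and>
        ((\<lambda>s. deriv u s) \<longlongrightarrow> - v) (at_left t))"

end

theory Submission
  imports Defs "HOL-Library.Periodic_Fun"
begin

text \<open>
  Let \<open>T = 2 m \<pi>\<close>. With \<open>u (\<tau> + T x) = T\<^sup>2 y x\<close>, an arc of a solution between two impacts at \<open>\<tau>\<close> and
  \<open>\<tau> + T\<close> becomes a positive solution of \<open>y'' = lam y\<^sup>-\<^sup>\<alpha> + p (\<tau> + T x)\<close>, \<open>y 0 = y 1 = 0\<close>, with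
  \<open>lam = T\<^sup>-\<^sup>2\<^sup>\<alpha>\<close> small for large \<open>m\<close>. Comparing with multiples of \<open>x (1 - x)\<close>, and using that
  \<open>(x (1 - x))\<^sup>-\<^sup>\<alpha>\<close> is integrable, this problem is a contraction in the norm weighted by \<open>x (1 - x)\<close>, so
  it has a solution that is Lipschitz in \<open>\<tau>\<close> in that norm. The action of this solution is then
  a differentiable function of \<open>\<tau>\<close> with derivative \<open>((y' 0)\<^sup>2 - (y' 1)\<^sup>2) / (2 T)\<close>: its critical points
  are the impact times for which the arc closes up to an elastic bounce. Since it is
  \<open>2\<pi>\<close>-periodic, it has two of them modulo \<open>2\<pi>\<close>, at its maximum and its minimum.
\<close>

section \<open>The Dirichlet Green operator on the unit interval\<close>

text \<open>\<open>green f\<close> solves \<open>- y'' = f\<close> with zero boundary values, and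
  \<open>green' f\<close> is its slope. Writing both through indefinite integrals keeps the slope
  continuous up to the endpoints even when \<open>f\<close> is singular there.\<close>

definition green' :: "(real \<Rightarrow> real) \<Rightarrow> real \<Rightarrow> real" where
  "green' f x = integral {0..1} (\<lambda>s. (1 - s) * f s) - integral {0..x} f"

definition green :: "(real \<Rightarrow> real) \<Rightarrow> real \<Rightarrow> real" where
  "green f x = integral {0..x} (\<lambda>s. s * f s) + x * green' f x"

lemma absolutely_integrable_continuous_mult:
  fixes f g :: "real \<Rightarrow> real"
  assumes "continuous_on {a..b} g" "f absolutely_integrable_on {a..b}"
  shows "(\<lambda>s. g s * f s) absolutely_integrable_on {a..b}"
proof (rule absolutely_integrable_bounded_measurable_product_real)
  show "g \<in> borel_measurable (lebesgue_on {a..b})"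
    using assms(1) by (intro continuous_imp_measurable_on_sets_lebesgue) auto
  show "bounded (g ` {a..b})"
    using assms(1) by (intro compact_imp_bounded compact_continuous_image) auto
qed (use assms in auto)

lemma integrable_continuous_mult:
  fixes f g :: "real \<Rightarrow> real"
  assumes "continuous_on {a..b} g" "f absolutely_integrable_on {a..b}"
  shows "(\<lambda>s. g s * f s) integrable_on {a..b}"
  using absolutely_integrable_continuous_mult[OF assms] set_lebesgue_integral_eq_integral(1) by blast

text \<open>Splitting \<open>f s\<close> as \<open>(1 - s) * f s + s * f s\<close> reveals the
  kernel \<open>min x s * (1 - max x s)\<close>. Its nonnegativity is behind monotonicity, its
  explicit form behind the weighted bound.\<close>

lemma green_eq_kernel:
  assumes f: "f absolutely_integrable_on {0..1}" and x: "x \<in> {0..1}"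
  shows "green f x = (1 - x) * integral {0..x} (\<lambda>s. s * f s) + x * integral {x..1} (\<lambda>s. (1 - s) * f s)"
proof -
  have i1: "(\<lambda>s. (1 - s) * f s) integrable_on {0..1}" "(\<lambda>s. s * f s) integrable_on {0..1}"
    by (intro integrable_continuous_mult f continuous_intros)+
  have i2: "(\<lambda>s. (1 - s) * f s) integrable_on {0..x}" "(\<lambda>s. s * f s) integrable_on {0..x}"
    using i1 x by (auto intro: integrable_subinterval_real)
  have c: "integral {0..1} (\<lambda>s. (1 - s) * f s)
      = integral {0..x} (\<lambda>s. (1 - s) * f s) + integral {x..1} (\<lambda>s. (1 - s) * f s)"
    using Henstock_Kurzweil_Integration.integral_combine[of 0 x 1, OF _ _ i1(1)] x by simp
  have "integral {0..x} f = integral {0..x} (\<lambda>s. (1 - s) * f s + s * f s)"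
    by (simp add: algebra_simps)
  also have "\<dots> = integral {0..x} (\<lambda>s. (1 - s) * f s) + integral {0..x} (\<lambda>s. s * f s)"
    using i2 by (rule Henstock_Kurzweil_Integration.integral_add)
  finally show ?thesis
    unfolding green_def green'_def c by (simp add: algebra_simps)
qed

lemma green_0 [simp]: "green f 0 = 0"
  by (simp add: green_def)

lemma green_1 [simp]:
  assumes "f absolutely_integrable_on {0..1}"
  shows "green f 1 = 0"
  using green_eq_kernel[OF assms, of 1] by simp

lemma green_diff:
  assumes f: "f absolutely_integrable_on {0..1}" and g: "g absolutely_integrable_on {0..1}"
    and x: "x \<in> {0..1}"
  shows "green (\<lambda>s. f s - g s) x = green f x - green g x"
proof -
  have sub: "h integrable_on {0..x}" "h integrable_on {x..1}"
    if "h integrable_on {0..1}" for h :: "real \<Rightarrow> real"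
    using that x by (auto intro: integrable_subinterval_real)
  note i = integrable_continuous_mult[OF _ f] integrable_continuous_mult[OF _ g]
  have i': "(\<lambda>s. s * f s) integrable_on {0..x}" "(\<lambda>s. s * g s) integrable_on {0..x}"
    "(\<lambda>s. (1 - s) * f s) integrable_on {x..1}" "(\<lambda>s. (1 - s) * g s) integrable_on {x..1}"
    by (intro sub i continuous_intros)+
  have "(\<lambda>s. f s - g s) absolutely_integrable_on {0..1}"
    using f g by (rule set_integral_diff)
  then show ?thesis
    using green_eq_kernel[OF _ x] f g
    by (simp add: right_diff_distrib Henstock_Kurzweil_Integration.integral_diff i')
qed

lemma green_mono:
  assumes f: "f absolutely_integrable_on {0..1}" and g: "g absolutely_integrable_on {0..1}"
    and x: "x \<in> {0..1}" and le: "\<And>s. s \<in> {0..1} \<Longrightarrow> f s \<le> g s"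
  shows "green f x \<le> green g x"
proof -
  have sub: "h integrable_on {0..x}" "h integrable_on {x..1}"
    if "h integrable_on {0..1}" for h :: "real \<Rightarrow> real"
    using that x by (auto intro: integrable_subinterval_real)
  note i = integrable_continuous_mult[OF _ f] integrable_continuous_mult[OF _ g]
  have "integral {0..x} (\<lambda>s. s * f s) \<le> integral {0..x} (\<lambda>s. s * g s)"
    using x by (intro integral_le sub i continuous_intros mult_left_mono le) auto
  moreover have "integral {x..1} (\<lambda>s. (1 - s) * f s) \<le> integral {x..1} (\<lambda>s. (1 - s) * g s)"
    using x by (intro integral_le sub i continuous_intros mult_left_mono le) auto
  ultimately show ?thesis
    unfolding green_eq_kernel[OF f x] green_eq_kernel[OF g x]
    using x by (intro add_mono mult_left_mono) auto
qed

text \<open>The kernel is at most \<open>x * (1 - x)\<close> for every \<open>s\<close>, so an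
  integrable bound on the source becomes a bound in the norm weighted by
  \<open>x * (1 - x)\<close>.\<close>

lemma abs_green_le:
  assumes f: "f absolutely_integrable_on {0..1}" and h: "h integrable_on {0..1}"
    and x: "x \<in> {0..1}" and le: "\<And>s. s \<in> {0..1} \<Longrightarrow> \<bar>f s\<bar> \<le> h s"
  shows "\<bar>green f x\<bar> \<le> x * (1 - x) * integral {0..1} h"
proof -
  have sub: "k integrable_on {0..x}" "k integrable_on {x..1}"
    if "k integrable_on {0..1}" for k :: "real \<Rightarrow> real"
    using that x by (auto intro: integrable_subinterval_real)
  note i = integrable_continuous_mult[OF _ f]
  have "norm (integral {0..x} (\<lambda>s. s * f s)) \<le> integral {0..x} (\<lambda>s. x * h s)"
  proof (rule integral_norm_bound_integral)
    show "norm (s * f s) \<le> x * h s" if "s \<in> {0..x}" for s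
      using that x le[of s] by (auto simp: abs_mult intro!: mult_mono)
  qed (intro sub i continuous_intros integrable_on_mult_right h)+
  then have A: "\<bar>integral {0..x} (\<lambda>s. s * f s)\<bar> \<le> x * integral {0..x} h" by simp
  have "norm (integral {x..1} (\<lambda>s. (1 - s) * f s)) \<le> integral {x..1} (\<lambda>s. (1 - x) * h s)"
  proof (rule integral_norm_bound_integral)
    show "norm ((1 - s) * f s) \<le> (1 - x) * h s" if "s \<in> {x..1}" for s
      using that x le[of s] by (auto simp: abs_mult intro!: mult_mono)
  qed (intro sub i continuous_intros integrable_on_mult_right h)+
  then have B: "\<bar>integral {x..1} (\<lambda>s. (1 - s) * f s)\<bar> \<le> (1 - x) * integral {x..1} h" by simp
  have "\<bar>green f x\<bar> \<le> (1 - x) * \<bar>integral {0..x} (\<lambda>s. s * f s)\<bar> + x * \<bar>integral {x..1} (\<lambda>s. (1 - s) * f s)\<bar>"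
    unfolding green_eq_kernel[OF f x] using x by (intro order_trans[OF abs_triangle_ineq]) (auto simp: abs_mult)
  also have "\<dots> \<le> (1 - x) * (x * integral {0..x} h) + x * ((1 - x) * integral {x..1} h)"
    using x A B by (intro add_mono mult_left_mono) auto
  also have "\<dots> = x * (1 - x) * (integral {0..x} h + integral {x..1} h)"
    by (simp add: algebra_simps)
  also have "integral {0..x} h + integral {x..1} h = integral {0..1} h"
    using Henstock_Kurzweil_Integration.integral_combine[of 0 x 1, OF _ _ h] x by simp
  finally show ?thesis .
qed

lemma green_const:
  assumes "x \<in> {0..1}"
  shows "green (\<lambda>_. c) x = c * (x * (1 - x)) / 2"
proof -
  have "((\<lambda>s::real. s * c) has_integral x\<^sup>2 / 2 * c - 0\<^sup>2 / 2 * c) {0..x}"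
    using assms by (intro fundamental_theorem_of_calculus)
      (auto simp flip: has_real_derivative_iff_has_vector_derivative intro!: derivative_eq_intros)
  note 1 = integral_unique[OF this]
  have "((\<lambda>s::real. (1 - s) * c) has_integral (1 - 1\<^sup>2 / 2) * c - (0 - 0\<^sup>2 / 2) * c) {0..1}"
    by (intro fundamental_theorem_of_calculus)
      (auto simp flip: has_real_derivative_iff_has_vector_derivative intro!: derivative_eq_intros)
  note 2 = integral_unique[OF this]
  show ?thesis using assms
    unfolding green_def green'_def 1 2 by (simp add: field_simps power2_eq_square)
qed

lemma continuous_on_green':
  assumes "f absolutely_integrable_on {0..1}"
  shows "continuous_on {0..1} (green' f)"
  unfolding green'_def using assms set_lebesgue_integral_eq_integral(1)
  by (intro continuous_intros indefinite_integral_continuous_1) blast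

lemma continuous_on_green:
  assumes "f absolutely_integrable_on {0..1}"
  shows "continuous_on {0..1} (green f)"
  unfolding green_def using assms
  by (intro continuous_intros indefinite_integral_continuous_1 continuous_on_green'
        integrable_continuous_mult)

lemma indefinite_integral_has_real_derivative:
  fixes f :: "real \<Rightarrow> real"
  assumes "f integrable_on {a..b}" "continuous_on {a<..<b} f" "x \<in> {a<..<b}"
  shows "((\<lambda>u. integral {a..u} f) has_real_derivative f x) (at x)"
proof -
  have "isCont f x" using assms by (simp add: continuous_on_eq_continuous_at)
  then have "continuous (at x within ({a..b} - {})) f"
    by (simp add: continuous_at_imp_continuous_at_within)
  then have "((\<lambda>u. integral {a..u} f) has_vector_derivative f x) (at x within ({a..b} - {}))"
    using assms by (intro integral_has_vector_derivative_continuous_at) auto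
  then show ?thesis
    using assms at_within_Icc_at[of a x b]
    by (simp add: has_real_derivative_iff_has_vector_derivative)
qed

lemma green'_has_real_derivative:
  assumes "f absolutely_integrable_on {0..1}" "continuous_on {0<..<1} f" "x \<in> {0<..<1}"
  shows "(green' f has_real_derivative - f x) (at x)"
  unfolding green'_def using assms set_lebesgue_integral_eq_integral(1)
  by (auto intro!: derivative_eq_intros indefinite_integral_has_real_derivative[of f 0 1])

lemma green_has_real_derivative:
  assumes f: "f absolutely_integrable_on {0..1}" "continuous_on {0<..<1} f" and x: "x \<in> {0<..<1}"
  shows "(green f has_real_derivative green' f x) (at x)"
proof -
  have "((\<lambda>x. integral {0..x} (\<lambda>s. s * f s)) has_real_derivative x * f x) (at x)"
    by (intro indefinite_integral_has_real_derivative[of "\<lambda>s. s * f s" 0 1] integrable_continuous_mult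
        f x continuous_intros)
  then show ?thesis
    unfolding green_def using green'_has_real_derivative[OF f x]
    by (auto intro!: derivative_eq_intros)
qed

section \<open>Passage to the limit and symmetry of the Green operator\<close>

lemma tendsto_integral_mult_dominated:
  fixes f :: "nat \<Rightarrow> real \<Rightarrow> real"
  assumes f: "\<And>n. f n absolutely_integrable_on {a..b}" and h: "h integrable_on {a..b}"
    and le: "\<And>n s. s \<in> {a..b} \<Longrightarrow> \<bar>f n s\<bar> \<le> h s"
    and lim: "\<And>s. s \<in> {a..b} \<Longrightarrow> (\<lambda>n. f n s) \<longlonglongrightarrow> F s"
    and g: "continuous_on {a..b} g" "\<And>s. s \<in> {a..b} \<Longrightarrow> \<bar>g s\<bar> \<le> 1"
  shows "(\<lambda>s. g s * F s) integrable_on {a..b}"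
    and "(\<lambda>n. integral {a..b} (\<lambda>s. g s * f n s)) \<longlonglongrightarrow> integral {a..b} (\<lambda>s. g s * F s)"
proof -
  have 1: "(\<lambda>s. g s * f n s) integrable_on {a..b}" for n
    by (intro integrable_continuous_mult g f)
  have 2: "norm (g s * f n s) \<le> h s" if "s \<in> {a..b}" for n s
    using mult_mono[OF g(2)[OF that] le[OF that, of n]] by (simp add: abs_mult)
  have 3: "(\<lambda>n. g s * f n s) \<longlonglongrightarrow> g s * F s" if "s \<in> {a..b}" for s
    by (intro tendsto_intros lim that)
  show "(\<lambda>s. g s * F s) integrable_on {a..b}"
    "(\<lambda>n. integral {a..b} (\<lambda>s. g s * f n s)) \<longlonglongrightarrow> integral {a..b} (\<lambda>s. g s * F s)"
    using dominated_convergence[OF 1 h 2 3] by auto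
qed

lemma green_dominated_convergence:
  assumes f: "\<And>n. f n absolutely_integrable_on {0..1}" and h: "h integrable_on {0..1}"
    and le: "\<And>n s. s \<in> {0..1} \<Longrightarrow> \<bar>f n s\<bar> \<le> h s"
    and lim: "\<And>s. s \<in> {0..1} \<Longrightarrow> (\<lambda>n. f n s) \<longlonglongrightarrow> F s"
  shows "F absolutely_integrable_on {0..1}"
    and "x \<in> {0..1} \<Longrightarrow> (\<lambda>n. green (f n) x) \<longlonglongrightarrow> green F x"
proof -
  have "F integrable_on {0..1}"
    using tendsto_integral_mult_dominated(1)[OF f h le lim, of "\<lambda>_. 1"] by simp
  moreover have "norm (F s) \<le> h s" if "s \<in> {0..1}" for s
  proof -
    have "(\<lambda>n. \<bar>f n s\<bar>) \<longlonglongrightarrow> \<bar>F s\<bar>" by (intro tendsto_intros lim that)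
    then show ?thesis using le that by (auto intro: LIMSEQ_le_const2)
  qed
  ultimately show F: "F absolutely_integrable_on {0..1}"
    using h by (blast intro: absolutely_integrable_integrable_bound)
  assume x: "x \<in> {0..1}"
  have sub: "f n absolutely_integrable_on {0..x}" "f n absolutely_integrable_on {x..1}" for n
    using f[of n] x by (auto intro: set_integrable_subset)
  have subh: "h integrable_on {0..x}" "h integrable_on {x..1}"
    using h x by (auto intro: integrable_subinterval_real)
  have "(\<lambda>n. integral {0..x} (\<lambda>s. s * f n s)) \<longlonglongrightarrow> integral {0..x} (\<lambda>s. s * F s)"
    using x by (intro tendsto_integral_mult_dominated(2)[OF sub(1) subh(1)] le lim) auto
  moreover have "(\<lambda>n. integral {x..1} (\<lambda>s. (1 - s) * f n s)) \<longlonglongrightarrow> integral {x..1} (\<lambda>s. (1 - s) * F s)"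
    using x by (intro tendsto_integral_mult_dominated(2)[OF sub(2) subh(2)] le lim continuous_intros) auto
  ultimately show "(\<lambda>n. green (f n) x) \<longlonglongrightarrow> green F x"
    unfolding green_eq_kernel[OF f x] green_eq_kernel[OF F x] by (intro tendsto_intros)
qed

text \<open>The derivative of the Wronskian \<open>?W\<close> is the difference of the two
  integrands, and \<open>?W\<close> vanishes at 0 and 1 because \<open>green f\<close> and
  \<open>green g\<close> do.\<close>

lemma green_symmetric:
  assumes f: "f absolutely_integrable_on {0..1}" "continuous_on {0<..<1} f"
    and g: "g absolutely_integrable_on {0..1}" "continuous_on {0<..<1} g"
  shows "integral {0..1} (\<lambda>x. green f x * g x) = integral {0..1} (\<lambda>x. green g x * f x)"
proof -
  let ?W = "\<lambda>x. green' f x * green g x - green f x * green' g x"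
  have "((\<lambda>x. green f x * g x - green g x * f x) has_integral ?W 1 - ?W 0) {0..1}"
  proof (rule fundamental_theorem_of_calculus_interior)
    show "continuous_on {0..1} ?W"
      by (intro continuous_intros continuous_on_green continuous_on_green' f g)
    show "(?W has_vector_derivative green f x * g x - green g x * f x) (at x)" if "x \<in> {0<..<1}" for x
      unfolding has_real_derivative_iff_has_vector_derivative[symmetric]
      using green_has_real_derivative[OF f that] green'_has_real_derivative[OF f that]
        green_has_real_derivative[OF g that] green'_has_real_derivative[OF g that]
      by (auto intro!: derivative_eq_intros)
  qed simp
  then have "integral {0..1} (\<lambda>x. green f x * g x - green g x * f x) = 0"
    using f g by (simp add: integral_unique)
  then show ?thesis
    by (simp add: Henstock_Kurzweil_Integration.integral_diff integrable_continuous_mult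
        continuous_on_green f g)
qed

section \<open>The singular Dirichlet problem\<close>

definition weight :: "real \<Rightarrow> real \<Rightarrow> real" where
  "weight \<alpha> x = (x * (1 - x)) powr (- \<alpha>)"

text \<open>After factoring the power of the product, this is the Beta integral with both parameters
  \<open>1 - \<alpha>\<close>, finite because \<open>\<alpha> < 1\<close>.\<close>

lemma weight_integrable:
  assumes "\<alpha> < 1"
  shows "weight \<alpha> integrable_on {0..1}"
proof -
  have "(\<lambda>t. t powr (1 - \<alpha> - 1) * (1 - t) powr (1 - \<alpha> - 1)) integrable_on {0..1}"
    using has_integral_Beta_real[of "1 - \<alpha>" "1 - \<alpha>"] assms by auto
  then show ?thesis
    by (rule integrable_eq) (auto simp: weight_def powr_mult)
qed

lemma weight_nonneg [simp]: "0 \<le> weight \<alpha> x"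
  by (simp add: weight_def)

lemma powr_neg_lipschitz:
  fixes a b k \<alpha> :: real
  assumes "0 < \<alpha>" "0 < k" "k \<le> a" "k \<le> b"
  shows "\<bar>a powr (-\<alpha>) - b powr (-\<alpha>)\<bar> \<le> \<alpha> * k powr (-\<alpha> - 1) * \<bar>a - b\<bar>"
proof -
  have "norm (a powr (-\<alpha>) - b powr (-\<alpha>)) \<le> \<alpha> * k powr (-\<alpha> - 1) * norm (a - b)"
  proof (rule field_differentiable_bound[where S = "{k..}" and f = "\<lambda>z. z powr (-\<alpha>)"
        and f' = "\<lambda>z. (-\<alpha>) * z powr (-\<alpha> - 1)"])
    show "((\<lambda>z. z powr (-\<alpha>)) has_field_derivative (-\<alpha>) * z powr (-\<alpha> - 1)) (at z within {k..})"
      if "z \<in> {k..}" for z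
      using that assms by (intro has_field_derivative_at_within[OF has_real_derivative_powr]) auto
    show "norm ((-\<alpha>) * z powr (-\<alpha> - 1)) \<le> \<alpha> * k powr (-\<alpha> - 1)" if "z \<in> {k..}" for z
      using that assms by (auto simp: abs_mult intro!: powr_mono2')
  qed (use assms in auto)
  then show ?thesis by simp
qed

text \<open>\<open>barrier_small\<close> lets the fixed-point map preserve the lower barrier;
  \<open>contraction_small\<close> gives it Lipschitz constant at most 1/2 in the norm weighted by
  \<open>x * (1 - x)\<close>. Both hold once \<open>lam\<close> is small.\<close>

locale singular_dirichlet =
  fixes \<alpha> lam c :: real
  assumes alpha: "0 < \<alpha>" "\<alpha> < 1" and lam: "0 < lam" and c: "0 < c"
    and barrier_small: "lam * (c / 4) powr (-\<alpha>) * integral {0..1} (weight \<alpha>) \<le> c / 4"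
    and contraction_small: "lam * \<alpha> * (c / 4) powr (-\<alpha> - 1) * integral {0..1} (weight \<alpha>) \<le> 1 / 2"
begin

section \<open>Barrier, source term and monotone iteration\<close>

definition forcing :: "(real \<Rightarrow> real) \<Rightarrow> bool" where
  "forcing P \<longleftrightarrow> continuous_on {0..1} P \<and> (\<forall>x\<in>{0..1}. P x \<le> - c)"

text \<open>For \<open>P = - c\<close> and without the singular term the solution is
  \<open>c / 2 * (x * (1 - x))\<close>; the barrier is half of it.\<close>

definition above_barrier :: "(real \<Rightarrow> real) \<Rightarrow> bool" where
  "above_barrier y \<longleftrightarrow> continuous_on {0..1} y \<and> y 0 = 0 \<and> y 1 = 0 \<and>
     (\<forall>x\<in>{0..1}. c / 4 * (x * (1 - x)) \<le> y x)"

text \<open>The right-hand side of \<open>- y'' = source P y\<close>. Since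
  \<open>0 powr (-\<alpha>) = 0\<close>, its value where \<open>y\<close> vanishes is just
  \<open>- P x\<close>, a convention that concerns only the two endpoints.\<close>

definition source :: "(real \<Rightarrow> real) \<Rightarrow> (real \<Rightarrow> real) \<Rightarrow> real \<Rightarrow> real" where
  "source P y x = - P x - lam * y x powr (-\<alpha>)"

text \<open>The boundary value problem as a fixed-point equation, so that no derivative has to be
  mentioned at the singular endpoints.\<close>

definition is_solution :: "(real \<Rightarrow> real) \<Rightarrow> (real \<Rightarrow> real) \<Rightarrow> bool" where
  "is_solution P y \<longleftrightarrow> above_barrier y \<and> (\<forall>x\<in>{0..1}. y x = green (source P y) x)"

lemma above_barrier_pos:
  assumes "above_barrier y" "x \<in> {0<..<1}"
  shows "0 < y x"
proof -
  have "0 < c / 4 * (x * (1 - x))" using assms c by simp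
  also have "\<dots> \<le> y x" using assms by (auto simp: above_barrier_def)
  finally show ?thesis .
qed

lemma above_barrier_nonneg:
  assumes "above_barrier y" "x \<in> {0..1}"
  shows "0 \<le> y x"
proof -
  have "0 \<le> c / 4 * (x * (1 - x))" using assms c by simp
  also have "\<dots> \<le> y x" using assms by (auto simp: above_barrier_def)
  finally show ?thesis .
qed

lemma powr_above_barrier_le:
  assumes y: "above_barrier y" and x: "x \<in> {0..1}"
  shows "y x powr (-\<alpha>) \<le> (c / 4) powr (-\<alpha>) * weight \<alpha> x"
proof (cases "x \<in> {0<..<1}")
  case True
  then have "y x powr (-\<alpha>) \<le> (c / 4 * (x * (1 - x))) powr (-\<alpha>)"
    using y c alpha x by (intro powr_mono2') (auto simp: above_barrier_def)
  also have "\<dots> = (c / 4) powr (-\<alpha>) * weight \<alpha> x"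
    unfolding weight_def by (rule powr_mult)
  finally show ?thesis .
next
  case False
  then have "x = 0 \<or> x = 1" using x by auto
  then show ?thesis using y by (auto simp: above_barrier_def)
qed

lemma continuous_source:
  assumes "continuous_on {0..1} P" "above_barrier y"
  shows "continuous_on {0<..<1} (source P y)"
proof -
  have "continuous_on {0<..<1} P" "continuous_on {0<..<1} y"
    using assms unfolding above_barrier_def by (auto elim: continuous_on_subset)
  then show ?thesis
    unfolding source_def using above_barrier_pos[OF assms(2)]
    by (intro continuous_intros) (metis less_irrefl)+
qed

text \<open>One integrable majorant that serves all functions above the barrier at once.\<close>

definition source_bound :: "(real \<Rightarrow> real) \<Rightarrow> real \<Rightarrow> real" where
  "source_bound P x = \<bar>P x\<bar> + lam * ((c / 4) powr (-\<alpha>) * weight \<alpha> x)"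

lemma source_bound_integrable:
  assumes "continuous_on {0..1} P"
  shows "source_bound P integrable_on {0..1}"
  unfolding source_bound_def using assms alpha
  by (intro integrable_add integrable_on_mult_right weight_integrable integrable_continuous_real
      continuous_intros) auto

lemma abs_source_le:
  assumes "above_barrier y" "x \<in> {0..1}"
  shows "\<bar>source P y x\<bar> \<le> source_bound P x"
proof -
  have "\<bar>source P y x\<bar> \<le> \<bar>P x\<bar> + lam * y x powr (-\<alpha>)"
    using lam unfolding source_def by (intro order_trans[OF abs_triangle_ineq4]) (simp add: abs_mult)
  also have "\<dots> \<le> source_bound P x"
    unfolding source_bound_def using lam powr_above_barrier_le[OF assms]
    by (intro add_mono mult_left_mono) auto
  finally show ?thesis .
qed

text \<open>Continuity gives measurability on the open interval, where \<open>y\<close> is positive;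
  adding the endpoints changes only a null set.\<close>

lemma source_absolutely_integrable:
  assumes P: "continuous_on {0..1} P" and y: "above_barrier y"
  shows "source P y absolutely_integrable_on {0..1}"
proof -
  have "source P y absolutely_integrable_on {0<..<1}"
  proof (rule measurable_bounded_by_integrable_imp_absolutely_integrable)
    show "source P y \<in> borel_measurable (lebesgue_on {0<..<1})"
      by (intro continuous_imp_measurable_on_sets_lebesgue continuous_source P y) auto
    show "source_bound P integrable_on {0<..<1}"
      using source_bound_integrable[OF P] integrable_on_Icc_iff_Ioo by blast
    show "norm (source P y x) \<le> source_bound P x" if "x \<in> {0<..<1}" for x
      using abs_source_le[OF y, of x P] that by auto
  qed auto
  moreover have "negligible {x \<in> {0..1} - {0<..<1}. source P y x \<noteq> 0}"
    by (rule negligible_subset[of "{0,1}"]) auto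
  moreover have "{x \<in> {0<..<1} - {0..1}. source P y x \<noteq> 0} = {}"
    by auto
  ultimately show ?thesis
    using absolutely_integrable_spike_set_eq[of "{0..1}" "{0<..<1}" "source P y"] negligible_empty
    by metis
qed

text \<open>The forcing alone contributes at least \<open>c / 2 * (x * (1 - x))\<close>, and by
  \<open>barrier_small\<close> the singular term takes away at most half of that.\<close>

lemma above_barrier_green_source:
  assumes P: "forcing P" and y: "above_barrier y"
  shows "above_barrier (green (source P y))"
proof -
  have Pc: "continuous_on {0..1} P" using P by (simp add: forcing_def)
  note S = source_absolutely_integrable[OF Pc y]
  have w: "(\<lambda>x. lam * ((c / 4) powr (-\<alpha>) * weight \<alpha> x)) integrable_on {0..1}"
    using alpha by (intro integrable_on_mult_right weight_integrable)
  then have wa: "(\<lambda>x. lam * ((c / 4) powr (-\<alpha>) * weight \<alpha> x)) absolutely_integrable_on {0..1}"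
    using lam by (intro nonnegative_absolutely_integrable_1) auto
  have ca: "(\<lambda>_. c) absolutely_integrable_on {0..1::real}"
    by (intro absolutely_integrable_continuous_real continuous_intros)
  have "c / 4 * (x * (1 - x)) \<le> green (source P y) x" if x: "x \<in> {0..1}" for x
  proof -
    let ?w = "\<lambda>x. lam * ((c / 4) powr (-\<alpha>) * weight \<alpha> x)"
    have "green ?w x \<le> x * (1 - x) * integral {0..1} ?w"
      using abs_green_le[OF wa w x] lam by (simp add: abs_le_iff)
    also have "\<dots> \<le> x * (1 - x) * (c / 4)"
      using barrier_small x by (intro mult_left_mono) (auto simp: mult_ac)
    finally have "green ?w x \<le> x * (1 - x) * (c / 4)" .
    moreover have "green (\<lambda>_. c) x = c / 4 * (x * (1 - x)) + x * (1 - x) * (c / 4)"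
      unfolding green_const[OF x] by (simp add: field_simps)
    ultimately have "c / 4 * (x * (1 - x)) \<le> green (\<lambda>_. c) x - green ?w x" by linarith
    also have "\<dots> = green (\<lambda>s. c - ?w s) x"
      using green_diff[OF ca wa x] by simp
    also have "\<dots> \<le> green (source P y) x"
    proof (rule green_mono[OF set_integral_diff(1)[OF ca wa] S x])
      fix s :: real assume s: "s \<in> {0..1}"
      have "lam * y s powr (-\<alpha>) \<le> ?w s"
        using lam powr_above_barrier_le[OF y s] by simp
      then show "c - ?w s \<le> source P y s"
        using P s by (force simp: forcing_def source_def)
    qed
    finally show ?thesis .
  qed
  then show ?thesis
    unfolding above_barrier_def using continuous_on_green[OF S] S by simp
qed

text \<open>On positive values \<open>- y powr (-\<alpha>)\<close> is increasing in
  \<open>y\<close>. At the endpoints the convention \<open>0 powr (-\<alpha>) = 0\<close> would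
  break this, so \<open>z\<close> has to vanish there too; then both sources equal
  \<open>- P x\<close>.\<close>

lemma source_mono:
  assumes y: "above_barrier y" and le: "\<And>x. x \<in> {0..1} \<Longrightarrow> y x \<le> z x" and "z 0 = 0" "z 1 = 0"
    and x: "x \<in> {0..1}"
  shows "source P y x \<le> source P z x"
proof (cases "x \<in> {0<..<1}")
  case True
  then have "z x powr (-\<alpha>) \<le> y x powr (-\<alpha>)"
    using above_barrier_pos[OF y True] le x alpha by (intro powr_mono2') auto
  then show ?thesis using lam by (simp add: source_def)
next
  case False
  then have "x = 0 \<or> x = 1" using x by auto
  then show ?thesis using assms by (auto simp: source_def above_barrier_def)
qed

text \<open>The map \<open>y \<mapsto> green (source P y)\<close> is increasing, because \<open>- y\<^sup>-\<^sup>\<alpha>\<close> is, and the barrier is a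
  subsolution; so its iterates from the barrier increase to a solution.\<close>

lemma solution_exists:
  assumes P: "forcing P"
  obtains y where "is_solution P y"
proof -
  have Pc: "continuous_on {0..1} P" using P by (simp add: forcing_def)
  define Y where "Y n = ((\<lambda>y. green (source P y)) ^^ n) (\<lambda>x. c / 4 * (x * (1 - x)))" for n
  have Y0: "Y 0 = (\<lambda>x. c / 4 * (x * (1 - x)))" and YS: "Y (Suc n) = green (source P (Y n))" for n
    by (simp_all add: Y_def)
  have bar: "above_barrier (Y n)" for n
  proof (induction n)
    case 0
    show ?case unfolding Y0 above_barrier_def by (auto intro!: continuous_intros)
  qed (simp add: YS above_barrier_green_source P)
  note S = source_absolutely_integrable[OF Pc bar]
  have ends: "Y n 0 = 0" "Y n 1 = 0" for n using bar[of n] by (auto simp: above_barrier_def)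
  have mono: "Y n x \<le> Y (Suc n) x" if "x \<in> {0..1}" for n x
    using that
  proof (induction n arbitrary: x)
    \<comment> \<open>The first step is the invariance of the barrier, since \<open>Y 0\<close> is
      the barrier itself.\<close>
    case 0
    then show ?case using bar[of 1] by (simp add: Y0 above_barrier_def)
  next
    case (Suc n)
    have "source P (Y n) s \<le> source P (Y (Suc n)) s" if "s \<in> {0..1}" for s
      by (rule source_mono[OF bar Suc.IH ends that])
    then show ?case
      using green_mono[OF S S Suc.prems, of n "Suc n"] by (simp only: YS)
  qed
  let ?I = "integral {0..1} (source_bound P)"
  have up: "Y n x \<le> x * (1 - x) * ?I" if x: "x \<in> {0..1}" for n x
  proof -
    \<comment> \<open>Passing to \<open>Suc n\<close> makes the iterate a Green value, also for
      \<open>n = 0\<close>; the resulting bound does not depend on \<open>n\<close>.\<close>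
    have "Y n x \<le> Y (Suc n) x" by (rule mono[OF x])
    also have "\<dots> \<le> x * (1 - x) * ?I"
      unfolding YS by (rule order_trans[OF abs_ge_self])
        (intro abs_green_le S source_bound_integrable Pc x abs_source_le bar)
    finally show ?thesis .
  qed
  define y where "y x = lim (\<lambda>n. Y n x)" for x
  have lim: "(\<lambda>n. Y n x) \<longlonglongrightarrow> y x" if x: "x \<in> {0..1}" for x
  proof -
    have "incseq (\<lambda>n. Y n x)" using mono[OF x] by (rule incseq_SucI)
    then obtain L where "(\<lambda>n. Y n x) \<longlonglongrightarrow> L"
      using incseq_convergent[of "\<lambda>n. Y n x"] up[OF x] by blast
    then show ?thesis unfolding y_def using limI by blast
  qed
  have yb: "c / 4 * (x * (1 - x)) \<le> y x" if x: "x \<in> {0..1}" for x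
    using lim[OF x] bar x by (intro LIMSEQ_le_const[OF lim[OF x]]) (auto simp: above_barrier_def)
  have y_ends: "y 0 = 0" "y 1 = 0" unfolding y_def using ends by simp_all
  have lim_source: "(\<lambda>n. source P (Y n) x) \<longlonglongrightarrow> source P y x" if x: "x \<in> {0..1}" for x
  proof (cases "x \<in> {0<..<1}")
    case True
    \<comment> \<open>Inside the interval the barrier keeps the limit away from 0, where the power
      is continuous.\<close>
    have "0 < c / 4 * (x * (1 - x))" using True c by simp
    then have "y x \<noteq> 0" using yb[OF x] by linarith
    then show ?thesis unfolding source_def by (intro tendsto_intros lim x) auto
  next
    case False
    then have "x = 0 \<or> x = 1" using x by auto
    then show ?thesis unfolding source_def by (auto simp: ends y_ends)
  qed
  note dom = green_dominated_convergence[OF S source_bound_integrable[OF Pc] abs_source_le[OF bar] lim_source]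
  have eq: "y x = green (source P y) x" if x: "x \<in> {0..1}" for x
  proof (rule LIMSEQ_unique)
    show "(\<lambda>n. Y (Suc n) x) \<longlonglongrightarrow> y x" using lim[OF x] by (rule LIMSEQ_Suc)
    show "(\<lambda>n. Y (Suc n) x) \<longlonglongrightarrow> green (source P y) x"
      unfolding YS by (rule dom(2)[OF _ _ x])
  qed
  have "continuous_on {0..1} y"
    using continuous_on_green[OF dom(1)] eq by (auto intro: continuous_on_eq)
  then have "is_solution P y"
    unfolding is_solution_def above_barrier_def using yb y_ends eq by blast
  then show ?thesis by (rule that)
qed

lemma is_solution_above_barrier: "is_solution P y \<Longrightarrow> above_barrier y"
  by (simp add: is_solution_def)

section \<open>Lipschitz dependence of the solution on the forcing\<close>

lemma solution_le:
  assumes "is_solution P y" "continuous_on {0..1} P" "x \<in> {0..1}"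
  shows "\<bar>y x\<bar> \<le> x * (1 - x) * integral {0..1} (source_bound P)"
proof -
  have y: "above_barrier y" "y x = green (source P y) x"
    using assms by (simp_all add: is_solution_def)
  show ?thesis
    unfolding y(2) by (intro abs_green_le source_absolutely_integrable source_bound_integrable
        abs_source_le assms y(1))
qed

text \<open>With \<open>M\<close> the weighted sup norm of \<open>y1 - y2\<close>, the fixed-point
  equations give \<open>M \<le> d + M / 2\<close>, hence \<open>M \<le> 2 * d\<close>. For
  \<open>d = 0\<close> this is uniqueness on the unit interval.\<close>

lemma solution_lipschitz:
  assumes P1: "continuous_on {0..1} P1" and y1: "is_solution P1 y1"
    and P2: "continuous_on {0..1} P2" and y2: "is_solution P2 y2"
    and d: "\<And>x. x \<in> {0..1} \<Longrightarrow> \<bar>P1 x - P2 x\<bar> \<le> d" and x: "x \<in> {0..1}"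
  shows "\<bar>y1 x - y2 x\<bar> \<le> 2 * d * (x * (1 - x))"
proof -
  note b1 = is_solution_above_barrier[OF y1] and b2 = is_solution_above_barrier[OF y2]
  note S1 = source_absolutely_integrable[OF P1 b1] and S2 = source_absolutely_integrable[OF P2 b2]
  define Q where "Q x = \<bar>y1 x - y2 x\<bar> / (x * (1 - x))" for x
  define M where "M = (SUP x\<in>{0<..<1}. Q x)"
  let ?I = "integral {0..1} (source_bound P1) + integral {0..1} (source_bound P2)"
  \<comment> \<open>\<open>M\<close> is finite because both solutions are bounded by multiples of
    \<open>x * (1 - x)\<close>; only then can \<open>M / 2\<close> be absorbed on the left.\<close>
  have bdd: "bdd_above (Q ` {0<..<1})"
  proof (rule bdd_aboveI2)
    fix x :: real assume x: "x \<in> {0<..<1}"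
    have "\<bar>y1 x - y2 x\<bar> \<le> \<bar>y1 x\<bar> + \<bar>y2 x\<bar>" by simp
    also have "\<dots> \<le> x * (1 - x) * ?I"
      using solution_le[OF y1 P1, of x] solution_le[OF y2 P2, of x] x by (simp add: distrib_left)
    finally show "Q x \<le> ?I" using x by (simp add: Q_def divide_le_eq mult_ac)
  qed
  have QM: "Q x \<le> M" if "x \<in> {0<..<1}" for x
    unfolding M_def using that bdd by (rule cSUP_upper)
  have "0 \<le> Q (1/2)" by (simp add: Q_def)
  also have "\<dots> \<le> M" by (rule QM) simp
  finally have M0: "0 \<le> M" .
  define K where "K = \<alpha> * (c / 4) powr (-\<alpha> - 1)"
  have K0: "0 \<le> K" using alpha by (simp add: K_def)
  define h where "h s = d + lam * (K * M) * weight \<alpha> s" for s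
  have src: "\<bar>source P1 y1 s - source P2 y2 s\<bar> \<le> h s" if s: "s \<in> {0..1}" for s
  proof -
    have "\<bar>y1 s powr (-\<alpha>) - y2 s powr (-\<alpha>)\<bar> \<le> K * M * weight \<alpha> s"
    proof (cases "s \<in> {0<..<1}")
      case True
      let ?q = "s * (1 - s)"
      have q: "0 < ?q" using True by simp
      have "\<bar>y1 s powr (-\<alpha>) - y2 s powr (-\<alpha>)\<bar> \<le> \<alpha> * (c / 4 * ?q) powr (-\<alpha> - 1) * \<bar>y1 s - y2 s\<bar>"
        using b1 b2 s q c alpha by (intro powr_neg_lipschitz) (auto simp: above_barrier_def)
      also have "\<dots> \<le> \<alpha> * (c / 4 * ?q) powr (-\<alpha> - 1) * (M * ?q)"
        using QM[OF True] q alpha by (intro mult_left_mono) (simp_all add: Q_def divide_le_eq)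
      also have "\<dots> = K * M * (?q powr (-\<alpha> - 1) * ?q)"
        using c q powr_mult[of "c / 4" ?q "-\<alpha> - 1"] by (simp add: K_def mult_ac)
      \<comment> \<open>The factor \<open>?q\<close> from the weighted difference cancels the extra
        singularity of the derivative of the power and leaves the integrable weight.\<close>
      also have "?q powr (-\<alpha> - 1) * ?q = weight \<alpha> s"
        unfolding weight_def using q by (simp add: powr_diff)
      finally show ?thesis .
    next
      case False
      then have "s = 0 \<or> s = 1" using s by auto
      then show ?thesis using b1 b2 M0 K0 by (auto simp: above_barrier_def)
    qed
    then have "lam * \<bar>y1 s powr (-\<alpha>) - y2 s powr (-\<alpha>)\<bar> \<le> lam * (K * M) * weight \<alpha> s"
      using lam by (simp add: mult.assoc)
    moreover have "\<bar>source P1 y1 s - source P2 y2 s\<bar>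
        \<le> \<bar>P1 s - P2 s\<bar> + \<bar>lam * (y1 s powr (-\<alpha>) - y2 s powr (-\<alpha>))\<bar>"
      by (simp add: source_def algebra_simps)
    moreover have "\<bar>lam * (y1 s powr (-\<alpha>) - y2 s powr (-\<alpha>))\<bar>
        = lam * \<bar>y1 s powr (-\<alpha>) - y2 s powr (-\<alpha>)\<bar>"
      using lam by (simp add: abs_mult)
    ultimately show ?thesis
      using d[OF s] unfolding h_def by linarith
  qed
  have hi: "h integrable_on {0..1}"
    unfolding h_def using alpha
    by (intro integrable_add integrable_on_mult_right weight_integrable integrable_const_ivl) auto
  have "integral {0..1} h = d + lam * (K * M) * integral {0..1} (weight \<alpha>)"
    unfolding h_def using alpha
    by (subst Henstock_Kurzweil_Integration.integral_add)
      (auto intro!: integrable_on_mult_right weight_integrable)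
  also have "lam * (K * M) * integral {0..1} (weight \<alpha>) \<le> M / 2"
    using mult_right_mono[OF contraction_small M0] by (simp add: K_def mult_ac)
  finally have hI: "integral {0..1} h \<le> d + M / 2" by simp
  have bound: "\<bar>y1 x - y2 x\<bar> \<le> x * (1 - x) * (d + M / 2)" if x: "x \<in> {0..1}" for x
  proof -
    have "y1 x - y2 x = green (\<lambda>s. source P1 y1 s - source P2 y2 s) x"
      using y1 y2 x green_diff[OF S1 S2 x] by (simp add: is_solution_def)
    then have "\<bar>y1 x - y2 x\<bar> \<le> x * (1 - x) * integral {0..1} h"
      using abs_green_le[OF set_integral_diff(1)[OF S1 S2] hi x src] by simp
    also have "\<dots> \<le> x * (1 - x) * (d + M / 2)"
      using x hI by (intro mult_left_mono) auto
    finally show ?thesis .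
  qed
  have "M \<le> d + M / 2"
    unfolding M_def
  proof (rule cSUP_least)
    show "Q x \<le> d + (SUP x\<in>{0<..<1}. Q x) / 2" if "x \<in> {0<..<1}" for x
      using bound[of x] that by (simp add: Q_def divide_le_eq mult_ac M_def)
  qed auto
  then have "d + M / 2 \<le> 2 * d" by simp
  then have "x * (1 - x) * (d + M / 2) \<le> x * (1 - x) * (2 * d)"
    using x by (intro mult_left_mono) auto
  then show ?thesis using bound[OF x] by (simp add: mult_ac)
qed

end

section \<open>The action as a function of the impact time\<close>

text \<open>\<open>p\<close> is only continuous, so the \<open>\<tau>\<close>-derivative is moved
  onto \<open>Y\<close>: integrating by parts with a primitive of \<open>p\<close> leaves no
  boundary terms, and the primitive can be differentiated under the integral.\<close>

lemma has_derivative_integral_translate: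
  fixes p Y Y' :: "real \<Rightarrow> real"
  assumes p: "continuous_on UNIV p" and T: "0 < T"
    and Y: "continuous_on {0..1} Y" "Y 0 = 0" "Y 1 = 0" and Y': "continuous_on {0..1} Y'"
    and der: "\<And>x. x \<in> {0<..<1} \<Longrightarrow> (Y has_real_derivative Y' x) (at x)"
  shows "((\<lambda>\<tau>. integral {0..1} (\<lambda>x. p (\<tau> + T * x) * Y x)) has_real_derivative
           - (1 / T) * integral {0..1} (\<lambda>x. p (\<tau> + T * x) * Y' x)) (at \<tau>)"
proof -
  \<comment> \<open>The margins keep \<open>s + T * x\<close> inside the interval where the
    primitive \<open>Q\<close> is differentiable, for all \<open>s\<close> within 1 of
    \<open>\<tau>\<close>.\<close>
  define a b where "a = \<tau> - 2" and "b = \<tau> + 2 + T"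
  define U where "U = {\<tau> - 1<..<\<tau> + 1}"
  define Q where "Q t = integral {a..t} p" for t
  have Q: "(Q has_real_derivative p t) (at t)" if "t \<in> {a<..<b}" for t
    unfolding Q_def using p that
    by (intro indefinite_integral_has_real_derivative[of p a b] integrable_continuous_real)
      (auto elim: continuous_on_subset)
  have mem: "s + T * x \<in> {a<..<b}" if "s \<in> U" "x \<in> {0..1}" for s x
  proof -
    have "0 \<le> T * x" "T * x \<le> T * 1" using that T by (auto intro: mult_left_mono)
    then show ?thesis using that by (auto simp: U_def a_def b_def)
  qed
  have QY: "((\<lambda>x. Q (s + T * x)) has_real_derivative p (s + T * x) * T) (at x)"
    if "s \<in> U" "x \<in> {0..1}" for s x
    by (rule DERIV_chain2[where g = "\<lambda>x. s + T * x", OF Q[OF mem[OF that]]])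
      (auto intro!: derivative_eq_intros)
  have Qc: "continuous_on {0..1} (\<lambda>x. Q (s + T * x))" if "s \<in> U" for s
    using QY[OF that] by (meson DERIV_continuous_on has_field_derivative_at_within)
  have pc: "continuous_on {0..1} (\<lambda>x. p (s + T * x))" for s
    by (rule continuous_on_compose2[OF p]) (auto intro!: continuous_intros)
  have parts: "integral {0..1} (\<lambda>x. p (s + T * x) * Y x)
      = - (1 / T) * integral {0..1} (\<lambda>x. Q (s + T * x) * Y' x)" if s: "s \<in> U" for s
  proof -
    let ?F = "\<lambda>x. Q (s + T * x) * Y x"
    have "((\<lambda>x. T * (p (s + T * x) * Y x) + Q (s + T * x) * Y' x) has_integral ?F 1 - ?F 0) {0..1}"
    proof (rule fundamental_theorem_of_calculus_interior)
      show "continuous_on {0..1} ?F" by (intro continuous_intros Qc s Y)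
      show "(?F has_vector_derivative T * (p (s + T * x) * Y x) + Q (s + T * x) * Y' x) (at x)"
        if x: "x \<in> {0<..<1}" for x
        unfolding has_real_derivative_iff_has_vector_derivative[symmetric]
        using QY[OF s, of x] der[OF x] x by (auto intro!: derivative_eq_intros)
    qed simp
    then have "integral {0..1} (\<lambda>x. T * (p (s + T * x) * Y x) + Q (s + T * x) * Y' x) = 0"
      using Y by (simp add: integral_unique)
    moreover have "integral {0..1} (\<lambda>x. T * (p (s + T * x) * Y x) + Q (s + T * x) * Y' x)
        = T * integral {0..1} (\<lambda>x. p (s + T * x) * Y x) + integral {0..1} (\<lambda>x. Q (s + T * x) * Y' x)"
      by (subst Henstock_Kurzweil_Integration.integral_add)
        (auto intro!: integrable_continuous_real continuous_intros Qc pc s Y Y')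
    ultimately show ?thesis using T by (simp add: field_simps)
  qed
  have leib: "((\<lambda>s. integral (cbox 0 1) (\<lambda>x. Q (s + T * x) * Y' x)) has_field_derivative
      integral (cbox 0 1) (\<lambda>x. p (\<tau> + T * x) * Y' x)) (at \<tau> within U)"
  proof (rule leibniz_rule_field_derivative)
    show "((\<lambda>s. Q (s + T * x) * Y' x) has_field_derivative p (s + T * x) * Y' x) (at s within U)"
      if "s \<in> U" "x \<in> cbox 0 1" for s x
    proof -
      have "((\<lambda>s. Q (s + T * x)) has_real_derivative p (s + T * x) * 1) (at s)"
        by (rule DERIV_chain2[where g = "\<lambda>s. s + T * x", OF Q[OF mem]]) (use that in \<open>auto intro!: derivative_eq_intros\<close>)
      from DERIV_cmult_right[OF this, of "Y' x"] show ?thesis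
        by (simp add: has_field_derivative_at_within)
    qed
    show "(\<lambda>x. Q (s + T * x) * Y' x) integrable_on cbox 0 1" if "s \<in> U" for s
      by (auto intro!: integrable_continuous_real continuous_intros Qc Y' that)
    have "continuous_on (U \<times> cbox 0 1) (\<lambda>z. p (fst z + T * snd z) * Y' (snd z))"
      by (intro continuous_intros continuous_on_compose2[OF p] continuous_on_compose2[OF Y']) auto
    then show "continuous_on (U \<times> cbox 0 1) (\<lambda>(s, x). p (s + T * x) * Y' x)"
      by (simp add: case_prod_unfold)
  qed (auto simp: U_def)
  have U: "open U" "\<tau> \<in> U" by (auto simp: U_def)
  have "((\<lambda>s. - (1 / T) * integral {0..1} (\<lambda>x. Q (s + T * x) * Y' x)) has_real_derivative
      - (1 / T) * integral {0..1} (\<lambda>x. p (\<tau> + T * x) * Y' x)) (at \<tau>)"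
    by (rule DERIV_cmult[OF leib[unfolded at_within_open[OF U(2,1)] cbox_interval]])
  then show ?thesis
    by (rule has_field_derivative_transform_within_open[OF _ U]) (simp add: parts)
qed

text \<open>The defect of the action between two solutions factors, pointwise, through this function of
  their ratio. It vanishes to first order at \<open>1\<close> exactly for this value of the coefficient.\<close>

lemma ratio_defect_has_derivative:
  fixes \<alpha> :: real
  assumes "\<alpha> < 1"
  shows "((\<lambda>r. (1 + \<alpha>) / (2 * (1 - \<alpha>)) * (r powr (1 - \<alpha>) - 1) + (r powr (-\<alpha>) - r) / 2)
    has_real_derivative 0) (at 1)"
  using assms by (auto intro!: derivative_eq_intros simp: field_simps)

text \<open>A wrong sign of the slope at an end would persist nearby and contradict the mean value
  theorem. These signs later single out \<open>y' 1 = - y' 0\<close> from equality of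
  squares.\<close>

lemma boundary_slope_signs:
  fixes f f' :: "real \<Rightarrow> real"
  assumes ab: "a < b" and f: "continuous_on {a..b} f" "f a = 0" "f b = 0"
    and pos: "\<And>x. x \<in> {a<..<b} \<Longrightarrow> 0 < f x" and f': "continuous_on {a..b} f'"
    and der: "\<And>x. x \<in> {a<..<b} \<Longrightarrow> (f has_real_derivative f' x) (at x)"
  shows "0 \<le> f' a" "f' b \<le> 0"
proof -
  have mean: "\<exists>z\<in>{s<..<t}. f t - f s = (t - s) * f' z" if "a \<le> s" "s < t" "t \<le> b" for s t
  proof -
    have "continuous_on {s..t} f" using f(1) that by (auto elim: continuous_on_subset)
    moreover have "(f has_derivative (*) (f' z)) (at z)" if "s < z" "z < t" for z
      using der[of z] that \<open>a \<le> s\<close> \<open>t \<le> b\<close> by (simp add: has_field_derivative_def)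
    ultimately obtain z where "s < z" "z < t" "f t - f s = f' z * (t - s)"
      using mvt[of s t f "\<lambda>z. (*) (f' z)"] \<open>s < t\<close> by metis
    then show ?thesis by (auto simp: mult.commute)
  qed
  show "0 \<le> f' a"
  proof (rule ccontr)
    assume "\<not> 0 \<le> f' a"
    then obtain d where d: "0 < d" "\<forall>x\<in>{a..b}. dist x a < d \<longrightarrow> dist (f' x) (f' a) < - f' a"
      using f' ab unfolding continuous_on_iff by (metis atLeastAtMost_iff less_imp_le neg_0_less_iff_less not_le order_refl)
    define t where "t = min (a + d / 2) ((a + b) / 2)"
    have t: "a < t" "t < a + d" "t < b" using d ab by (auto simp: t_def min_def)
    obtain z where z: "z \<in> {a<..<t}" "f t - f a = (t - a) * f' z" using mean[of a t] t by auto
    have "0 < (t - a) * f' z" using pos[of t] t z f by auto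
    then have "0 < f' z" using t by (simp add: zero_less_mult_iff)
    moreover have "dist (f' z) (f' a) < - f' a" using d(2) z t by (auto simp: dist_real_def)
    ultimately show False by (auto simp: dist_real_def)
  qed
  show "f' b \<le> 0"
  proof (rule ccontr)
    assume "\<not> f' b \<le> 0"
    then obtain d where d: "0 < d" "\<forall>x\<in>{a..b}. dist x b < d \<longrightarrow> dist (f' x) (f' b) < f' b"
      using f' ab unfolding continuous_on_iff by (metis atLeastAtMost_iff less_imp_le not_le order_refl)
    define t where "t = max (b - d / 2) ((a + b) / 2)"
    have t: "a < t" "b - d < t" "t < b" using d ab by (auto simp: t_def max_def)
    obtain z where z: "z \<in> {t<..<b}" "f b - f t = (b - t) * f' z" using mean[of t b] t by auto
    have "(b - t) * f' z < 0" using pos[of t] t z f by auto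
    then have "f' z < 0" using t by (simp add: mult_less_0_iff)
    moreover have "dist (f' z) (f' b) < f' b" using d(2) z t by (auto simp: dist_real_def)
    ultimately show False by (auto simp: dist_real_def)
  qed
qed

section \<open>Solutions of the rescaled problem as functions of the impact time\<close>

locale forced_dirichlet = singular_dirichlet +
  fixes p :: "real \<Rightarrow> real" and T L :: real
  assumes lipschitz: "\<bar>p s - p t\<bar> \<le> L * \<bar>s - t\<bar>" and L: "0 < L" and T: "0 < T"
    and p_le: "p t \<le> - c"
begin

definition force :: "real \<Rightarrow> real \<Rightarrow> real" where
  "force \<tau> x = p (\<tau> + T * x)"

text \<open>The choice depends on \<open>\<tau>\<close> only through \<open>force \<tau>\<close>, so
  it inherits the periodicity of the forcing.\<close>

definition sol :: "real \<Rightarrow> real \<Rightarrow> real" where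
  "sol \<tau> = (SOME y. is_solution (force \<tau>) y)"

definition src :: "real \<Rightarrow> real \<Rightarrow> real" where
  "src \<tau> = source (force \<tau>) (sol \<tau>)"

text \<open>Taken from the Green operator, so that it is continuous on the closed interval and its
  values at 0 and 1 are the one-sided boundary slopes.\<close>

definition dsol :: "real \<Rightarrow> real \<Rightarrow> real" where
  "dsol \<tau> = green' (src \<tau>)"

text \<open>On a solution, \<open>\<integral> y'\<^sup>2 / 2 + lam y\<^sup>1\<^sup>-\<^sup>\<alpha> / (1 - \<alpha>) + P y\<close> takes this derivative-free form, since
  \<open>\<integral> y'\<^sup>2 = - \<integral> y y''\<close>.\<close>

definition action :: "real \<Rightarrow> real" where
  "action \<tau> = integral {0..1} (\<lambda>x. lam * ((1 + \<alpha>) / (2 * (1 - \<alpha>))) * sol \<tau> x powr (1 - \<alpha>)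
     + force \<tau> x * sol \<tau> x / 2)"

lemma continuous_p: "continuous_on UNIV p"
  by (rule lipschitz_on_continuous_on[of L])
    (use lipschitz L in \<open>auto simp: lipschitz_on_def dist_real_def\<close>)

lemma continuous_force: "continuous_on {0..1} (force \<tau>)"
  unfolding force_def by (rule continuous_on_compose2[OF continuous_p]) (auto intro!: continuous_intros)

lemma sol_is_solution: "is_solution (force \<tau>) (sol \<tau>)"
proof -
  have "forcing (force \<tau>)"
    unfolding forcing_def using continuous_force p_le by (auto simp: force_def)
  then show ?thesis
    unfolding sol_def using solution_exists someI_ex by metis
qed

lemma sol_above: "above_barrier (sol \<tau>)"
  by (rule is_solution_above_barrier[OF sol_is_solution])

lemma continuous_sol: "continuous_on {0..1} (sol \<tau>)"
  and sol_0: "sol \<tau> 0 = 0" and sol_1: "sol \<tau> 1 = 0"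
  using sol_above[of \<tau>] by (auto simp: above_barrier_def)

lemma src_absolutely_integrable: "src \<tau> absolutely_integrable_on {0..1}"
  unfolding src_def by (intro source_absolutely_integrable continuous_force sol_above)

lemma continuous_src: "continuous_on {0<..<1} (src \<tau>)"
  unfolding src_def by (intro continuous_source continuous_force sol_above)

lemma sol_eq_green: "x \<in> {0..1} \<Longrightarrow> sol \<tau> x = green (src \<tau>) x"
  using sol_is_solution by (simp add: is_solution_def src_def)

lemma continuous_dsol: "continuous_on {0..1} (dsol \<tau>)"
  unfolding dsol_def by (intro continuous_on_green' src_absolutely_integrable)

lemma sol_has_derivative:
  assumes "x \<in> {0<..<1}"
  shows "(sol \<tau> has_real_derivative dsol \<tau> x) (at x)"
proof (rule has_field_derivative_transform_within_open)
  show "(green (src \<tau>) has_real_derivative dsol \<tau> x) (at x)"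
    unfolding dsol_def
    by (intro green_has_real_derivative src_absolutely_integrable continuous_src assms)
  show "green (src \<tau>) s = sol \<tau> s" if "s \<in> {0<..<1}" for s
    using that by (simp add: sol_eq_green)
qed (use assms in auto)

lemma dsol_has_derivative:
  assumes "x \<in> {0<..<1}"
  shows "(dsol \<tau> has_real_derivative lam * sol \<tau> x powr (-\<alpha>) + force \<tau> x) (at x)"
  using green'_has_real_derivative[OF src_absolutely_integrable continuous_src assms, of \<tau>]
  unfolding dsol_def by (simp add: src_def source_def algebra_simps)

lemma continuous_sol_powr: "continuous_on {0..1} (\<lambda>x. sol \<tau> x powr (1 - \<alpha>))"
  using alpha above_barrier_nonneg[OF sol_above]
  by (intro continuous_on_powr' continuous_sol continuous_intros) auto

text \<open>Energy identity: \<open>?W\<close> has derivative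
  \<open>y' * (y'' - lam * y powr (-\<alpha>))\<close>, the power of the forcing. As
  \<open>\<alpha> < 1\<close>, its potential part is continuous up to the ends and vanishes
  there.\<close>

lemma integral_force_dsol:
  "integral {0..1} (\<lambda>x. force \<tau> x * dsol \<tau> x) = ((dsol \<tau> 1)\<^sup>2 - (dsol \<tau> 0)\<^sup>2) / 2"
proof -
  let ?W = "\<lambda>x. (dsol \<tau> x)\<^sup>2 / 2 - lam * sol \<tau> x powr (1 - \<alpha>) / (1 - \<alpha>)"
  have "((\<lambda>x. force \<tau> x * dsol \<tau> x) has_integral ?W 1 - ?W 0) {0..1}"
  proof (rule fundamental_theorem_of_calculus_interior)
    show "continuous_on {0..1} ?W"
      using alpha by (intro continuous_intros continuous_dsol continuous_sol_powr) auto
    show "(?W has_vector_derivative force \<tau> x * dsol \<tau> x) (at x)" if x: "x \<in> {0<..<1}" for x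
    proof -
      have pos: "0 < sol \<tau> x" by (rule above_barrier_pos[OF sol_above x])
      have "((\<lambda>x. sol \<tau> x powr (1 - \<alpha>)) has_real_derivative
          (1 - \<alpha>) * sol \<tau> x powr (1 - \<alpha> - 1) * dsol \<tau> x) (at x)"
        by (rule DERIV_chain2[OF has_real_derivative_powr[OF pos] sol_has_derivative[OF x]])
      from DERIV_diff[OF DERIV_cdivide[OF DERIV_power[OF dsol_has_derivative[OF x, of \<tau>], of 2], of 2]
          DERIV_cdivide[OF DERIV_cmult[OF this, of lam], of "1 - \<alpha>"]]
      have "(?W has_real_derivative force \<tau> x * dsol \<tau> x) (at x)"
        by (rule DERIV_cong) (use alpha in \<open>simp add: field_simps\<close>)
      then show ?thesis by (simp add: has_real_derivative_iff_has_vector_derivative)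
    qed
  qed simp
  then show ?thesis
    by (simp add: integral_unique sol_0 sol_1 diff_divide_distrib)
qed

text \<open>The integrand of the change of the action, minus its change when the forcing moves and
  \<open>sol \<tau>\<close> stays frozen, plus an antisymmetric term in \<open>sol\<close> and
  \<open>src\<close>. Here \<open>src + force\<close> is just the singular term
  \<open>- lam * y powr (-\<alpha>)\<close>.\<close>

definition defect :: "real \<Rightarrow> real \<Rightarrow> real \<Rightarrow> real" where
  "defect \<tau> \<sigma> x =
     lam * ((1 + \<alpha>) / (2 * (1 - \<alpha>))) * (sol \<sigma> x powr (1 - \<alpha>) - sol \<tau> x powr (1 - \<alpha>))
     + (sol \<sigma> x * (src \<tau> x + force \<tau> x) - sol \<tau> x * (src \<sigma> x + force \<sigma> x)) / 2
     + (force \<sigma> x - force \<tau> x) * (sol \<sigma> x - sol \<tau> x) / 2"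

text \<open>By symmetry of the Green operator, the terms with \<open>src\<close> in the defect integrate to zero.\<close>

lemma integral_defect:
  "defect \<tau> \<sigma> integrable_on {0..1}"
  "integral {0..1} (defect \<tau> \<sigma>) = action \<sigma> - action \<tau>
     - (integral {0..1} (\<lambda>x. force \<sigma> x * sol \<tau> x) - integral {0..1} (\<lambda>x. force \<tau> x * sol \<tau> x))"
proof -
  define A where "A \<tau> x = lam * ((1 + \<alpha>) / (2 * (1 - \<alpha>))) * sol \<tau> x powr (1 - \<alpha>)
     + force \<tau> x * sol \<tau> x / 2" for \<tau> x
  have iA: "A \<tau> integrable_on {0..1}" for \<tau>
    unfolding A_def
    by (intro integrable_continuous_real continuous_intros continuous_sol_powr continuous_force
        continuous_sol) auto
  have iF: "(\<lambda>x. force \<sigma> x * sol \<tau> x) integrable_on {0..1}" for \<sigma> \<tau>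
    by (intro integrable_continuous_real continuous_intros continuous_force continuous_sol)
  have iS: "(\<lambda>x. sol \<sigma> x * src \<tau> x) integrable_on {0..1}" for \<sigma> \<tau>
    by (intro integrable_continuous_mult continuous_sol src_absolutely_integrable)
  have "integral {0..1} (\<lambda>x. sol \<sigma> x * src \<tau> x) = integral {0..1} (\<lambda>x. green (src \<sigma>) x * src \<tau> x)"
    for \<sigma> \<tau> by (intro Henstock_Kurzweil_Integration.integral_cong) (simp add: sol_eq_green)
  then have sym: "integral {0..1} (\<lambda>x. sol \<sigma> x * src \<tau> x) = integral {0..1} (\<lambda>x. sol \<tau> x * src \<sigma> x)"
    using green_symmetric[OF src_absolutely_integrable continuous_src
        src_absolutely_integrable continuous_src] by simp
  have "defect \<tau> \<sigma> = (\<lambda>x. (A \<sigma> x - A \<tau> x) - (force \<sigma> x * sol \<tau> x - force \<tau> x * sol \<tau> x)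
      + (sol \<sigma> x * src \<tau> x - sol \<tau> x * src \<sigma> x) / 2)"
    by (simp add: fun_eq_iff defect_def A_def algebra_simps add_divide_distrib diff_divide_distrib)
  moreover have "((\<lambda>x. (A \<sigma> x - A \<tau> x) - (force \<sigma> x * sol \<tau> x - force \<tau> x * sol \<tau> x)
      + (sol \<sigma> x * src \<tau> x - sol \<tau> x * src \<sigma> x) / 2) has_integral
      (action \<sigma> - action \<tau>) - (integral {0..1} (\<lambda>x. force \<sigma> x * sol \<tau> x)
        - integral {0..1} (\<lambda>x. force \<tau> x * sol \<tau> x))
      + (integral {0..1} (\<lambda>x. sol \<sigma> x * src \<tau> x) - integral {0..1} (\<lambda>x. sol \<tau> x * src \<sigma> x)) / 2) {0..1}"
    unfolding action_def A_def[symmetric]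
    by (intro has_integral_add has_integral_diff has_integral_divide integrable_integral iA iF iS)
  ultimately show "defect \<tau> \<sigma> integrable_on {0..1}"
    "integral {0..1} (defect \<tau> \<sigma>) = action \<sigma> - action \<tau>
     - (integral {0..1} (\<lambda>x. force \<sigma> x * sol \<tau> x) - integral {0..1} (\<lambda>x. force \<tau> x * sol \<tau> x))"
    using sym by (auto dest: integral_unique)
qed

section \<open>First-order expansion of the action\<close>

lemma force_lipschitz: "\<bar>force \<sigma> x - force \<tau> x\<bar> \<le> L * \<bar>\<sigma> - \<tau>\<bar>"
  using lipschitz[of "\<sigma> + T * x" "\<tau> + T * x"] by (simp add: force_def)

lemma sol_lipschitz:
  assumes "x \<in> {0..1}"
  shows "\<bar>sol \<sigma> x - sol \<tau> x\<bar> \<le> 2 * (L * \<bar>\<sigma> - \<tau>\<bar>) * (x * (1 - x))"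
  by (rule solution_lipschitz[OF continuous_force sol_is_solution continuous_force sol_is_solution
        force_lipschitz assms])

text \<open>All singular terms are homogeneous of degree \<open>1 - \<alpha>\<close> in the pair of
  solutions, so a power of \<open>sol \<tau> x\<close> factors out and a function of the ratio
  remains.\<close>

lemma defect_eq_ratio:
  fixes \<tau> \<sigma> x
  assumes x: "x \<in> {0<..<1}"
  defines "r \<equiv> sol \<sigma> x / sol \<tau> x"
  shows "defect \<tau> \<sigma> x = lam * sol \<tau> x powr (1 - \<alpha>)
       * ((1 + \<alpha>) / (2 * (1 - \<alpha>)) * (r powr (1 - \<alpha>) - 1) + (r powr (-\<alpha>) - r) / 2)
     + (force \<sigma> x - force \<tau> x) * (sol \<sigma> x - sol \<tau> x) / 2"
proof -
  have pos: "0 < sol \<sigma> x" "0 < sol \<tau> x" by (rule above_barrier_pos[OF sol_above x])+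
  define y z where "y = sol \<tau> x" and "z = sol \<sigma> x"
  have yz: "0 < y" "0 < z" "z = y * r" "0 < r" using pos by (auto simp: y_def z_def r_def)
  have 1: "z powr (1 - \<alpha>) = y powr (1 - \<alpha>) * r powr (1 - \<alpha>)" "y * z powr (-\<alpha>) = y powr (1 - \<alpha>) * r powr (-\<alpha>)"
    using yz powr_add[of y 1 "-\<alpha>"] by (simp_all add: powr_mult)
  have 2: "z * y powr (-\<alpha>) = y powr (1 - \<alpha>) * r"
    using yz powr_add[of y 1 "-\<alpha>"] by simp
  have "sol \<sigma> x * (src \<tau> x + force \<tau> x) - sol \<tau> x * (src \<sigma> x + force \<sigma> x)
      = lam * (y * z powr (-\<alpha>) - z * y powr (-\<alpha>))"
    by (simp add: src_def source_def y_def z_def algebra_simps)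
  also have "\<dots> = lam * y powr (1 - \<alpha>) * (r powr (-\<alpha>) - r)"
    unfolding 1 2 by (simp add: algebra_simps)
  finally have 3: "sol \<sigma> x * (src \<tau> x + force \<tau> x) - sol \<tau> x * (src \<sigma> x + force \<sigma> x)
      = lam * y powr (1 - \<alpha>) * (r powr (-\<alpha>) - r)" .
  define k where "k = (1 + \<alpha>) / (2 * (1 - \<alpha>))"
  show ?thesis
    unfolding defect_def 3 unfolding k_def[symmetric] y_def[symmetric] z_def[symmetric] 1
    by (simp add: algebra_simps diff_divide_distrib)
qed

text \<open>An envelope argument: to first order only the explicit dependence of the forcing on
  \<open>\<tau>\<close> counts. That part is \<open>F\<close>, with the solution frozen at
  \<open>\<tau>\<close>; the remainder is the integral of the defect and has derivative 0.\<close>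

lemma action_has_derivative:
  "(action has_real_derivative ((dsol \<tau> 0)\<^sup>2 - (dsol \<tau> 1)\<^sup>2) / (2 * T)) (at \<tau>)"
proof -
  define F where "F \<sigma> = integral {0..1} (\<lambda>x. force \<sigma> x * sol \<tau> x)" for \<sigma>
  have "(F has_real_derivative - (1 / T) * integral {0..1} (\<lambda>x. force \<tau> x * dsol \<tau> x)) (at \<tau>)"
    unfolding F_def force_def
    by (intro has_derivative_integral_translate continuous_p T continuous_sol sol_0 sol_1
        continuous_dsol sol_has_derivative)
  then have F: "(F has_real_derivative ((dsol \<tau> 0)\<^sup>2 - (dsol \<tau> 1)\<^sup>2) / (2 * T)) (at \<tau>)"
    by (rule DERIV_cong) (use T in \<open>simp add: integral_force_dsol field_simps\<close>)
  let ?g = "\<lambda>r. (1 + \<alpha>) / (2 * (1 - \<alpha>)) * (r powr (1 - \<alpha>) - 1) + (r powr (-\<alpha>) - r) / 2"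
  obtain K where K: "0 < K" "\<And>x. x \<in> {0..1} \<Longrightarrow> sol \<tau> x powr (1 - \<alpha>) \<le> K"
  proof -
    have "compact ((\<lambda>x. sol \<tau> x powr (1 - \<alpha>)) ` {0..1})"
      by (intro compact_continuous_image continuous_sol_powr) auto
    then obtain K where "\<forall>z\<in>(\<lambda>x. sol \<tau> x powr (1 - \<alpha>)) ` {0..1}. norm z \<le> K" "K > 0"
      using compact_imp_bounded bounded_pos by metis
    then show ?thesis using that by force
  qed
  have "((\<lambda>\<sigma>. action \<sigma> - F \<sigma>) has_derivative (\<lambda>h. 0)) (at \<tau>)"
    unfolding has_derivative_at_alt
  proof (intro conjI allI impI)
    fix e :: real assume e: "0 < e"
    \<comment> \<open>Chosen so that \<open>lam * K * (e' * (8 * L / c * ?h))\<close> is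
      \<open>e / 2 * ?h\<close>: the singular part and the forcing part of the defect each get half
      of \<open>e\<close>.\<close>
    define e' where "e' = e * c / (16 * lam * K * L)"
    have e': "0 < e'" using e c lam K L by (simp add: e'_def)
    have "(?g has_derivative (\<lambda>h. 0)) (at 1)"
      using ratio_defect_has_derivative[OF alpha(2)] by (simp only: has_field_derivative_def lambda_zero)
    then obtain d where d: "0 < d" "\<And>r. \<bar>r - 1\<bar> < d \<Longrightarrow> \<bar>?g r\<bar> \<le> e' * \<bar>r - 1\<bar>"
      using e' unfolding has_derivative_at_alt by auto
    \<comment> \<open>The first bound makes the product of the two Lipschitz differences small
      against \<open>?h\<close>; the second keeps the ratio of the solutions within \<open>d\<close>
      of 1.\<close>
    define \<delta> where "\<delta> = min (e / (2 * L\<^sup>2)) (d * c / (8 * L))"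
    have "0 < \<delta>" using e d c L by (simp add: \<delta>_def)
    moreover have "norm (action \<sigma> - F \<sigma> - (action \<tau> - F \<tau>) - 0) \<le> e * norm (\<sigma> - \<tau>)"
      if "norm (\<sigma> - \<tau>) < \<delta>" for \<sigma>
    proof -
      let ?h = "\<bar>\<sigma> - \<tau>\<bar>"
      have h: "?h < e / (2 * L\<^sup>2)" "?h < d * c / (8 * L)" using that by (auto simp: \<delta>_def)
      have "norm (defect \<tau> \<sigma> x) \<le> e * ?h" if x: "x \<in> {0..1}" for x
      proof (cases "x \<in> {0<..<1}")
        case True
        define q where "q = x * (1 - x)"
        have q: "0 < q" "q \<le> 1" using True by (auto simp: q_def mult_le_one)
        have yq: "c / 4 * q \<le> sol \<tau> x" using sol_above[of \<tau>] x by (auto simp: above_barrier_def q_def)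
        have pos: "0 < sol \<tau> x" by (rule above_barrier_pos[OF sol_above True])
        define r where "r = sol \<sigma> x / sol \<tau> x"
        have dy: "\<bar>sol \<sigma> x - sol \<tau> x\<bar> \<le> 2 * (L * ?h) * q"
          using sol_lipschitz[OF x] by (simp add: q_def)
        have "r - 1 = (sol \<sigma> x - sol \<tau> x) / sol \<tau> x"
          using pos by (simp add: r_def field_simps)
        then have "\<bar>r - 1\<bar> = \<bar>sol \<sigma> x - sol \<tau> x\<bar> / sol \<tau> x"
          using pos by simp
        \<comment> \<open>The weighted Lipschitz bound is divided by the barrier, so
          \<open>q\<close> cancels and the ratio is close to 1 uniformly up to the
          endpoints.\<close>
        also have "\<dots> \<le> 2 * (L * ?h) * q / (c / 4 * q)"
          using dy yq q c L by (intro frac_le) auto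
        also have "\<dots> = 8 * L / c * ?h" using q c by (simp add: field_simps)
        finally have r: "\<bar>r - 1\<bar> \<le> 8 * L / c * ?h" .
        also have "\<dots> < d" using h(2) c L by (simp add: field_simps)
        finally have "\<bar>?g r\<bar> \<le> e' * \<bar>r - 1\<bar>" by (rule d(2))
        also have "\<dots> \<le> e' * (8 * L / c * ?h)" using r e' by (intro mult_left_mono) auto
        finally have "lam * sol \<tau> x powr (1 - \<alpha>) * \<bar>?g r\<bar> \<le> lam * K * (e' * (8 * L / c * ?h))"
          using lam K(2)[OF x] K(1) by (intro mult_mono) auto
        also have "\<dots> = e / 2 * ?h"
          using lam K(1) L c by (simp add: e'_def field_simps)
        finally have g: "\<bar>lam * sol \<tau> x powr (1 - \<alpha>) * ?g r\<bar> \<le> e / 2 * ?h"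
          using lam by (simp add: abs_mult)
        have "\<bar>(force \<sigma> x - force \<tau> x) * (sol \<sigma> x - sol \<tau> x)\<bar>
            \<le> (L * ?h) * (2 * (L * ?h) * q)"
          unfolding abs_mult using dy L force_lipschitz by (intro mult_mono) auto
        then have "\<bar>(force \<sigma> x - force \<tau> x) * (sol \<sigma> x - sol \<tau> x) / 2\<bar>
            \<le> (L * ?h) * (2 * (L * ?h) * q) / 2" by simp
        also have "\<dots> = L\<^sup>2 * ?h * ?h * q" by (simp add: power2_eq_square)
        also have "\<dots> \<le> L\<^sup>2 * ?h * ?h * 1" using q by (intro mult_left_mono) auto
        also have "\<dots> \<le> e / 2 * ?h"
          using h(1) L unfolding mult_1_right by (intro mult_right_mono) (auto simp: field_simps)
        finally have "\<bar>(force \<sigma> x - force \<tau> x) * (sol \<sigma> x - sol \<tau> x) / 2\<bar> \<le> e / 2 * ?h" .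
        from order_trans[OF abs_triangle_ineq add_mono[OF g this]] show ?thesis
          unfolding defect_eq_ratio[OF True] r_def[symmetric] real_norm_def
          by (simp only: flip: distrib_right) simp
      next
        case False
        then have "x = 0 \<or> x = 1" using x by auto
        then show ?thesis using e by (auto simp: defect_def sol_0 sol_1)
      qed
      then have "norm (integral {0..1} (defect \<tau> \<sigma>)) \<le> integral {0..1} (\<lambda>x::real. e * ?h)"
        by (intro integral_norm_bound_integral integral_defect(1)) auto
      then show ?thesis unfolding integral_defect(2) F_def[symmetric] by (simp add: algebra_simps)
    qed
    ultimately show "\<exists>d>0. \<forall>\<sigma>. norm (\<sigma> - \<tau>) < d \<longrightarrow>
        norm (action \<sigma> - F \<sigma> - (action \<tau> - F \<tau>) - 0) \<le> e * norm (\<sigma> - \<tau>)" by blast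
  qed (auto intro: bounded_linear_zero)
  then have "((\<lambda>\<sigma>. action \<sigma> - F \<sigma>) has_real_derivative 0) (at \<tau>)"
    by (simp only: has_field_derivative_def lambda_zero)
  from DERIV_add[OF this F] show ?thesis by simp
qed

lemma action_periodic:
  assumes "\<And>t. p (t + w) = p t"
  shows "action (\<tau> + w) = action \<tau>"
proof -
  have "force (\<tau> + w) x = force \<tau> x" for x
    using assms[of "\<tau> + T * x"] by (simp add: force_def add_ac)
  then have "force (\<tau> + w) = force \<tau>" by blast
  then show ?thesis by (simp add: action_def sol_def)
qed

lemma dsol_0_nonneg: "0 \<le> dsol \<tau> 0" and dsol_1_nonpos: "dsol \<tau> 1 \<le> 0"
  using boundary_slope_signs[OF _ continuous_sol sol_0 sol_1 above_barrier_pos[OF sol_above]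
      continuous_dsol sol_has_derivative] by auto

end

section \<open>Periodic extension of an arc between impacts\<close>

text \<open>The factor \<open>T powr (- (2 * \<alpha>))\<close> is what \<open>T\<^sup>2 * y\<close>
  produces in the singular term, and \<open>y' 1 = - y' 0\<close> is the elastic bounce.\<close>

locale arc =
  fixes \<alpha> T \<tau> :: real and p y y' :: "real \<Rightarrow> real"
  assumes T: "0 < T" and p: "continuous_on UNIV p" and p_periodic: "\<And>t. p (t + T) = p t"
    and y: "continuous_on {0..1} y" "y 0 = 0" "y 1 = 0" "\<And>x. x \<in> {0<..<1} \<Longrightarrow> 0 < y x"
    and y': "continuous_on {0..1} y'" "y' 1 = - y' 0"
    and der: "\<And>x. x \<in> {0<..<1} \<Longrightarrow> (y has_real_derivative y' x) (at x)"
    and der': "\<And>x. x \<in> {0<..<1} \<Longrightarrow>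
      (y' has_real_derivative T powr (- (2 * \<alpha>)) * y x powr (-\<alpha>) + p (\<tau> + T * x)) (at x)"
begin

definition phase :: "real \<Rightarrow> real" where
  "phase t = frac ((t - \<tau>) / T)"

definition bounce :: "real \<Rightarrow> real" where
  "bounce t = T\<^sup>2 * y (phase t)"

definition cell :: "int \<Rightarrow> real set" where
  "cell k = {\<tau> + k * T<..<\<tau> + (k + 1) * T}"

lemma phase_cell:
  assumes "t \<in> cell k"
  shows "phase t = (t - \<tau>) / T - k" "phase t \<in> {0<..<1}"
proof -
  have "k < (t - \<tau>) / T" "(t - \<tau>) / T < k + 1"
    using assms T by (auto simp: cell_def field_simps)
  moreover from this have "\<lfloor>(t - \<tau>) / T\<rfloor> = k" by linarith
  ultimately show "phase t = (t - \<tau>) / T - k" "phase t \<in> {0<..<1}"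
    by (auto simp: phase_def frac_def)
qed

lemma phase_add_period: "phase (t + T) = phase t"
proof -
  have "(t + T - \<tau>) / T = (t - \<tau>) / T + 1" using T by (simp add: field_simps)
  then show ?thesis by (simp add: phase_def frac_1_eq)
qed

lemma cell_or_impact:
  obtains k where "t \<in> cell k" | k :: int where "t = \<tau> + k * T"
proof -
  define k where "k = \<lfloor>(t - \<tau>) / T\<rfloor>"
  have "k \<le> (t - \<tau>) / T" "(t - \<tau>) / T < k + 1" unfolding k_def by linarith+
  then have "\<tau> + k * T \<le> t" "t < \<tau> + (k + 1) * T" using T by (auto simp: field_simps)
  then have "t \<in> cell k \<or> t = \<tau> + k * T" by (auto simp: cell_def)
  then show ?thesis using that by blast
qed

lemma phase_impact: "phase (\<tau> + of_int k * T) = 0"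
  using T by (simp add: phase_def)

lemma bounce_pos: "t \<in> cell k \<Longrightarrow> 0 < bounce t"
  using y(4) phase_cell(2) T by (simp add: bounce_def)

lemma zero_set_bounce: "zero_set bounce = range (\<lambda>k::int. \<tau> + k * T)"
proof (intro equalityI subsetI)
  fix t assume "t \<in> zero_set bounce"
  then have "bounce t = 0" by (simp add: zero_set_def)
  then show "t \<in> range (\<lambda>k::int. \<tau> + k * T)"
    using bounce_pos[of t] by (cases t rule: cell_or_impact) auto
qed (auto simp: zero_set_def bounce_def phase_impact y)

lemma open_cell: "open (cell k)"
  by (simp add: cell_def)

lemma phase_has_derivative:
  assumes "t \<in> cell k"
  shows "(phase has_real_derivative 1 / T) (at t)"
proof (rule has_field_derivative_transform_within_open[OF _ open_cell assms])
  show "((\<lambda>t. (t - \<tau>) / T - k) has_real_derivative 1 / T) (at t)"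
    using T by (auto intro!: derivative_eq_intros)
qed (simp add: phase_cell)

lemma bounce_has_derivative:
  assumes "t \<in> cell k"
  shows "(bounce has_real_derivative T * y' (phase t)) (at t)"
proof -
  have "((\<lambda>t. y (phase t)) has_real_derivative y' (phase t) * (1 / T)) (at t)"
    by (rule DERIV_chain2[OF der phase_has_derivative]) (use phase_cell assms in auto)
  from DERIV_cmult[OF this, of "T\<^sup>2"] show ?thesis
    using T by (simp add: bounce_def[abs_def] power2_eq_square)
qed

text \<open>The factor \<open>T\<^sup>2\<close> in \<open>bounce\<close> offsets the two factors
  \<open>1 / T\<close> from the change of time, so the accelerations agree.\<close>

lemma bounce_has_second_derivative:
  assumes t: "t \<in> cell k"
  shows "((\<lambda>t. T * y' (phase t)) has_real_derivative bounce t powr (-\<alpha>) + p t) (at t)"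
proof -
  interpret periodic_fun_simple p T by standard (rule p_periodic)
  have "((\<lambda>t. y' (phase t)) has_real_derivative
      (T powr (- (2 * \<alpha>)) * y (phase t) powr (-\<alpha>) + p (\<tau> + T * phase t)) * (1 / T)) (at t)"
    by (rule DERIV_chain2[OF der' phase_has_derivative]) (use phase_cell t in auto)
  note D = DERIV_cmult[OF this, of T]
  have "T\<^sup>2 powr (-\<alpha>) = T powr (- (2 * \<alpha>))"
    using T powr_powr[of T 2 "-\<alpha>"] by simp
  then have "bounce t powr (-\<alpha>) = T powr (- (2 * \<alpha>)) * y (phase t) powr (-\<alpha>)"
    using T y(4)[OF phase_cell(2)[OF t]] by (simp add: bounce_def powr_mult)
  \<comment> \<open>\<open>phase\<close> drops \<open>k\<close> whole periods, which the periodicity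
    of \<open>p\<close> makes up for.\<close>
  moreover have "\<tau> + T * phase t = t - k * T"
    using T by (simp add: phase_cell(1)[OF t] field_simps)
  then have "p (\<tau> + T * phase t) = p t"
    by (simp only: minus_of_int)
  ultimately show ?thesis
    using D T by simp
qed

text \<open>At an impact \<open>phase\<close> restarts: it tends to 0 from the right and to 1 from
  the left, so the one-sided limits see opposite ends of the arc.\<close>

lemma tendsto_phase_impact:
  assumes G: "continuous_on {0..1} G"
  shows "((\<lambda>s. G (phase s)) \<longlongrightarrow> G 0) (at_right (\<tau> + of_int k * T))"
    and "((\<lambda>s. G (phase s)) \<longlongrightarrow> G 1) (at_left (\<tau> + of_int k * T))"
proof -
  let ?t = "\<tau> + of_int k * T"
  have R: "\<forall>\<^sub>F s in at_right ?t. s \<in> cell k"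
    using T unfolding cell_def by (auto simp: eventually_at_right_field algebra_simps intro!: exI[of _ "?t + T"])
  \<comment> \<open>To the left of impact \<open>k\<close> lies the preceding cell.\<close>
  have L: "\<forall>\<^sub>F s in at_left ?t. s \<in> cell (k - 1)"
    using T unfolding cell_def by (auto simp: eventually_at_left_field algebra_simps intro!: exI[of _ "?t - T"])
  have GR: "(G \<longlongrightarrow> G 0) (at 0 within {0..1})" and GL: "(G \<longlongrightarrow> G 1) (at 1 within {0..1})"
    using G by (auto simp: continuous_on_def)
  have "((\<lambda>s. (s - \<tau>) / T - k) \<longlongrightarrow> (?t - \<tau>) / T - k) (at_right ?t)"
    using T by (intro tendsto_intros) auto
  then have "((\<lambda>s. (s - \<tau>) / T - k) \<longlongrightarrow> 0) (at_right ?t)" using T by simp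
  then have "(phase \<longlongrightarrow> 0) (at_right ?t)"
    by (rule Lim_transform_eventually) (use R in eventually_elim, simp add: phase_cell)
  moreover have "\<forall>\<^sub>F s in at_right ?t. phase s \<in> {0..1} \<and> phase s \<noteq> 0"
    using R by eventually_elim (use phase_cell(2) in force)
  ultimately have "filterlim phase (at 0 within {0..1}) (at_right ?t)"
    by (simp add: filterlim_at)
  then show "((\<lambda>s. G (phase s)) \<longlongrightarrow> G 0) (at_right ?t)"
    by (rule filterlim_compose[OF GR])
  have "((\<lambda>s. (s - \<tau>) / T - (k - 1)) \<longlongrightarrow> (?t - \<tau>) / T - (k - 1)) (at_left ?t)"
    using T by (intro tendsto_intros) auto
  then have "((\<lambda>s. (s - \<tau>) / T - (k - 1)) \<longlongrightarrow> 1) (at_left ?t)" using T by simp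
  then have "(phase \<longlongrightarrow> 1) (at_left ?t)"
    by (rule Lim_transform_eventually) (use L in eventually_elim, simp add: phase_cell)
  moreover have "\<forall>\<^sub>F s in at_left ?t. phase s \<in> {0..1} \<and> phase s \<noteq> 1"
    using L by eventually_elim (use phase_cell(2) in force)
  ultimately have "filterlim phase (at 1 within {0..1}) (at_left ?t)"
    by (simp add: filterlim_at)
  then show "((\<lambda>s. G (phase s)) \<longlongrightarrow> G 1) (at_left ?t)"
    by (rule filterlim_compose[OF GL])
qed

section \<open>Continuity, isolated impacts and the bounce condition\<close>

lemma isCont_bounce: "isCont bounce t"
proof (cases t rule: cell_or_impact)
  case (1 k)
  then show ?thesis using bounce_has_derivative DERIV_isCont by blast
next
  case (2 k)
  \<comment> \<open>Both one-sided limits are 0, since \<open>y\<close> vanishes at both ends of the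
    arc.\<close>
  have "continuous_on {0..1} (\<lambda>x. T\<^sup>2 * y x)" by (intro continuous_intros y)
  from tendsto_phase_impact[OF this, of k] show ?thesis
    unfolding isCont_def 2
    by (intro filterlim_split_at) (simp_all add: bounce_def[abs_def] phase_impact y)
qed

lemma impacts_isolated:
  assumes "t \<in> zero_set bounce" "s \<in> zero_set bounce" "\<bar>s - t\<bar> < T"
  shows "s = t"
proof -
  obtain j k :: int where jk: "t = \<tau> + j * T" "s = \<tau> + k * T"
    using assms unfolding zero_set_bounce by auto
  then have "s - t = of_int (k - j) * T" by (simp add: algebra_simps)
  then have "\<bar>of_int (k - j)\<bar> * T < 1 * T" using assms T by (simp add: abs_mult)
  then have "\<bar>of_int (k - j) :: real\<bar> < 1" using T by (simp only: mult_less_cancel_right_pos)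
  then have "k = j" by linarith
  then show ?thesis using jk by simp
qed

lemma bouncing_solution_bounce: "bouncing_solution \<alpha> p bounce"
  unfolding bouncing_solution_def
proof (intro conjI)
  show cont: "continuous_on UNIV bounce"
    using isCont_bounce by (simp add: continuous_at_imp_continuous_on)
  show "\<forall>t. 0 \<le> bounce t"
  proof
    show "0 \<le> bounce t" for t
      by (cases t rule: cell_or_impact) (auto simp: bounce_def phase_impact y dest: bounce_pos)
  qed
  show "\<forall>t\<in>zero_set bounce. \<exists>e>0. \<forall>s\<in>zero_set bounce. \<bar>s - t\<bar> < e \<longrightarrow> s = t"
    using impacts_isolated T by blast
  show "\<forall>a b. {a<..<b} \<inter> zero_set bounce = {} \<longrightarrow>
        (\<exists>u' u''. (\<forall>t\<in>{a<..<b}. (bounce has_real_derivative u' t) (at t) \<and>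
                                 (u' has_real_derivative u'' t) (at t) \<and>
                                 u'' t - 1 / (bounce t powr \<alpha>) = p t) \<and>
                   continuous_on {a<..<b} u'')"
  proof (intro allI impI)
    fix a b assume ab: "{a<..<b} \<inter> zero_set bounce = {}"
    let ?u' = "\<lambda>t. T * y' (phase t)" and ?u'' = "\<lambda>t. bounce t powr (-\<alpha>) + p t"
    have D: "(bounce has_real_derivative ?u' t) (at t) \<and> (?u' has_real_derivative ?u'' t) (at t) \<and>
        ?u'' t - 1 / (bounce t powr \<alpha>) = p t" if t: "t \<in> {a<..<b}" for t
    proof -
      \<comment> \<open>The formulas for the derivatives do not mention the cell, so it suffices
        that each point lies in some cell.\<close>
      have "t \<notin> range (\<lambda>k::int. \<tau> + k * T)" using ab t zero_set_bounce by auto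
      then obtain k where "t \<in> cell k" by (cases t rule: cell_or_impact) auto
      then show ?thesis
        using bounce_has_derivative bounce_has_second_derivative
        by (simp add: powr_minus_divide)
    qed
    have C: "continuous_on {a<..<b} ?u''"
    proof (intro continuous_intros)
      show "continuous_on {a<..<b} bounce" "continuous_on {a<..<b} p"
        using cont p by (auto elim: continuous_on_subset)
      show "\<forall>t\<in>{a<..<b}. bounce t \<noteq> 0" using ab by (auto simp: zero_set_def)
    qed
    show "\<exists>u' u''. (\<forall>t\<in>{a<..<b}. (bounce has_real_derivative u' t) (at t) \<and>
                                 (u' has_real_derivative u'' t) (at t) \<and>
                                 u'' t - 1 / (bounce t powr \<alpha>) = p t) \<and>
                   continuous_on {a<..<b} u''" 
      by (rule exI[of _ ?u'], rule exI[of _ ?u''], rule conjI[OF ballI C], rule D)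
  qed
  show "\<forall>t\<in>zero_set bounce. \<exists>v. (deriv bounce \<longlongrightarrow> v) (at_right t) \<and> (deriv bounce \<longlongrightarrow> - v) (at_left t)"
  proof
    fix t assume "t \<in> zero_set bounce"
    then obtain k :: int where k: "t = \<tau> + k * T" unfolding zero_set_bounce by auto
    have c: "continuous_on {0..1} (\<lambda>x. T * y' x)" by (intro continuous_intros y')
    \<comment> \<open>The derivative formula is available on cells; other impacts are at least
      \<open>T\<close> away, so it holds in a punctured neighbourhood of each impact.\<close>
    have "T * y' (phase s) = deriv bounce s" if "s \<notin> zero_set bounce" for s
      using that bounce_has_derivative[THEN DERIV_imp_deriv, of s] unfolding zero_set_bounce
      by (cases s rule: cell_or_impact) auto
    moreover have "\<forall>\<^sub>F s in at t. s \<notin> zero_set bounce"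
      using impacts_isolated[OF \<open>t \<in> zero_set bounce\<close>] T
      unfolding eventually_at dist_real_def by blast
    ultimately have ev: "\<forall>\<^sub>F s in at t. T * y' (phase s) = deriv bounce s"
      by (auto elim: eventually_mono)
    then have "\<forall>\<^sub>F s in at_right t. T * y' (phase s) = deriv bounce s"
      "\<forall>\<^sub>F s in at_left t. T * y' (phase s) = deriv bounce s"
      by (auto simp: eventually_at_split)
    then have "(deriv bounce \<longlongrightarrow> T * y' 0) (at_right t)" "(deriv bounce \<longlongrightarrow> T * y' 1) (at_left t)"
      using tendsto_phase_impact[OF c, of k] unfolding k by (auto intro: Lim_transform_eventually)
    then show "\<exists>v. (deriv bounce \<longlongrightarrow> v) (at_right t) \<and> (deriv bounce \<longlongrightarrow> - v) (at_left t)"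
      using y'(2) by (intro exI[of _ "T * y' 0"]) simp
  qed
qed

lemma bounce_add_period: "bounce (t + T) = bounce t"
  by (simp add: bounce_def phase_add_period)

lemma card_impacts:
  assumes "0 \<le> \<tau>" "\<tau> < T"
  shows "card (zero_set bounce \<inter> {0..<T}) = 1"
proof -
  have "\<tau> \<in> zero_set bounce" unfolding zero_set_bounce by (rule range_eqI[of _ _ 0]) simp
  then have "zero_set bounce \<inter> {0..<T} = {\<tau>}"
    using assms impacts_isolated[of \<tau>] by (auto simp: abs_less_iff)
  then show ?thesis by simp
qed

end

section \<open>Critical points of periodic functions\<close>

text \<open>Maximum and minimum points are moved into the half-open interval, so that distinct
  points are also distinct modulo \<open>w\<close>.\<close>

lemma periodic_two_critical_points:
  fixes f f' :: "real \<Rightarrow> real"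
  assumes der: "\<And>x. (f has_real_derivative f' x) (at x)" and per: "\<And>x. f (x + w) = f x" and w: "0 < w"
  obtains a b where "a \<in> {0..<w}" "b \<in> {0..<w}" "a \<noteq> b" "f' a = 0" "f' b = 0"
proof -
  interpret periodic_fun_simple f w by standard (rule per)
  have reduce: "\<exists>t\<in>{0..<w}. f t = f x" for x
  proof
    show "f (x - of_int \<lfloor>x / w\<rfloor> * w) = f x" by (rule minus_of_int)
    show "x - of_int \<lfloor>x / w\<rfloor> * w \<in> {0..<w}"
      using floor_divide_lower[OF w, of x] floor_divide_upper[OF w, of x] by (simp add: algebra_simps)
  qed
  have cont: "continuous_on {0..w} f"
    using der by (meson DERIV_continuous_on has_field_derivative_at_within)
  obtain a0 where "\<forall>x\<in>{0..w}. f x \<le> f a0"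
    using continuous_attains_sup[OF _ _ cont] w by auto
  then obtain a where a: "a \<in> {0..<w}" "\<And>x. f x \<le> f a"
    using reduce by (metis atLeastLessThan_iff atLeastAtMost_iff less_imp_le)
  obtain b0 where "\<forall>x\<in>{0..w}. f b0 \<le> f x"
    using continuous_attains_inf[OF _ _ cont] w by auto
  then obtain b where b: "b \<in> {0..<w}" "\<And>x. f b \<le> f x"
    using reduce by (metis atLeastLessThan_iff atLeastAtMost_iff less_imp_le)
  show ?thesis
  proof (cases "f a = f b")
    case True
    \<comment> \<open>Equal extreme values force \<open>f\<close> to be constant, and any two points
      of the period will do.\<close>
    then have max: "f y \<le> f x" for x y using a(2)[of y] b(2)[of x] by linarith
    then have "f' x = 0" for x
      using DERIV_local_max[OF der, of 1 x] by auto
    then show ?thesis using that[of 0 "w / 2"] w by auto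
  next
    case False
    moreover have "f' a = 0" using DERIV_local_max[OF der, of 1 a] a by auto
    moreover have "f' b = 0" using DERIV_local_min[OF der, of 1 b] b by auto
    ultimately show ?thesis using that a b by blast
  qed
qed

section \<open>Large periods and two solutions distinct modulo time shifts\<close>

theorem theorem4p4:
  fixes \<alpha> :: real and p :: "real \<Rightarrow> real"
  assumes "0 < \<alpha>" and "\<alpha> < 1"
    and "\<exists>L. \<forall>x y. \<bar>p x - p y\<bar> \<le> L * \<bar>x - y\<bar>"
    and "\<forall>t. p (t + 2 * pi) = p t"
    and "\<forall>t. p t < 0"
  shows "\<exists>m1::nat. \<forall>m::nat. m \<ge> m1 \<longrightarrow>
           (\<exists>u1 u2.
              bouncing_solution \<alpha> p u1 \<and> bouncing_solution \<alpha> p u2 \<and>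
              (\<forall>t. u1 (t + 2 * real m * pi) = u1 t) \<and>
              (\<forall>t. u2 (t + 2 * real m * pi) = u2 t) \<and>
              card (zero_set u1 \<inter> {0..<2 * real m * pi}) = 1 \<and>
              card (zero_set u2 \<inter> {0..<2 * real m * pi}) = 1 \<and>
              (\<forall>k::int. u2 \<noteq> (\<lambda>t. u1 (t + 2 * real_of_int k * pi))))"
proof -
  interpret per: periodic_fun_simple p "2 * pi" by standard (use assms in auto)
  obtain L0 where L0: "\<And>x y. \<bar>p x - p y\<bar> \<le> L0 * \<bar>x - y\<bar>" using assms(3) by auto
  \<comment> \<open>Positive even when \<open>p\<close> is constant and \<open>L0\<close> is
    0.\<close>
  define L where "L = \<bar>L0\<bar> + 1"
  have L: "0 < L" "\<And>x y. \<bar>p x - p y\<bar> \<le> L * \<bar>x - y\<bar>"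
  proof -
    show "\<bar>p x - p y\<bar> \<le> L * \<bar>x - y\<bar>" for x y
      by (rule order_trans[OF L0 mult_right_mono]) (auto simp: L_def)
  qed (simp add: L_def)
  have cont: "continuous_on UNIV p"
    by (rule lipschitz_on_continuous_on[of L])
      (use L in \<open>auto simp: lipschitz_on_def dist_real_def\<close>)
  \<comment> \<open>A continuous periodic function attains its maximum, so negativity of
    \<open>p\<close> becomes a uniform bound.\<close>
  obtain c where c: "0 < c" "\<And>t. p t \<le> - c"
  proof -
    have "continuous_on {0..2 * pi} p" using cont by (rule continuous_on_subset) simp
    then obtain t0 where t0: "\<forall>t\<in>{0..2 * pi}. p t \<le> p t0"
      using continuous_attains_sup[of "{0..2 * pi}" p] by auto
    have "p t \<le> p t0" for t
    proof -
      let ?k = "\<lfloor>t / (2 * pi)\<rfloor>"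
      have "t - ?k * (2 * pi) \<in> {0..2 * pi}"
        using floor_divide_lower[of "2 * pi" t] floor_divide_upper[of "2 * pi" t]
        by (simp add: algebra_simps)
      then show ?thesis using t0 per.minus_of_int[of t ?k] by metis
    qed
    then show ?thesis using that[of "- p t0"] assms(5) by simp
  qed
  define T where "T m = 2 * real m * pi" for m
  have "filterlim (\<lambda>m. 2 * pi * real m) at_top sequentially"
    by (intro filterlim_tendsto_pos_mult_at_top[OF tendsto_const _ filterlim_real_sequentially]) simp
  then have "(\<lambda>m. T m powr (- (2 * \<alpha>))) \<longlonglongrightarrow> 0"
    unfolding T_def using assms(1) by (intro tendsto_neg_powr) (auto simp: mult_ac)
  then have lim: "(\<lambda>m. T m powr (- (2 * \<alpha>)) * K) \<longlonglongrightarrow> 0" for K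
    using tendsto_mult_left_zero by blast
  define W where "W = integral {0..1} (weight \<alpha>)"
  \<comment> \<open>Both smallness conditions bound a constant times
    \<open>T m powr (- (2 * \<alpha>))\<close>, which tends to 0.\<close>
  have "\<forall>\<^sub>F m in sequentially. T m powr (- (2 * \<alpha>)) * ((c / 4) powr (-\<alpha>) * W) < c / 4"
    "\<forall>\<^sub>F m in sequentially. T m powr (- (2 * \<alpha>)) * (\<alpha> * (c / 4) powr (-\<alpha> - 1) * W) < 1 / 2"
    by (rule order_tendstoD(2)[OF lim]; use c in simp)+
  \<comment> \<open>\<open>1 \<le> m\<close> makes the period positive and at least
    \<open>2 * pi\<close>.\<close>
  then have "\<forall>\<^sub>F m in sequentially. 1 \<le> m \<and> T m powr (- (2 * \<alpha>)) * ((c / 4) powr (-\<alpha>) * W) < c / 4 \<and>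
      T m powr (- (2 * \<alpha>)) * (\<alpha> * (c / 4) powr (-\<alpha> - 1) * W) < 1 / 2"
    using eventually_ge_at_top[of 1] by eventually_elim auto
  then obtain m1 where m1: "\<And>m. m1 \<le> m \<Longrightarrow> 1 \<le> m \<and>
      T m powr (- (2 * \<alpha>)) * ((c / 4) powr (-\<alpha>) * W) < c / 4 \<and>
      T m powr (- (2 * \<alpha>)) * (\<alpha> * (c / 4) powr (-\<alpha> - 1) * W) < 1 / 2"
    unfolding eventually_sequentially by blast
  have "\<exists>u1 u2. bouncing_solution \<alpha> p u1 \<and> bouncing_solution \<alpha> p u2 \<and>
      (\<forall>t. u1 (t + T m) = u1 t) \<and> (\<forall>t. u2 (t + T m) = u2 t) \<and>
      card (zero_set u1 \<inter> {0..<T m}) = 1 \<and> card (zero_set u2 \<inter> {0..<T m}) = 1 \<and>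
      (\<forall>k::int. u2 \<noteq> (\<lambda>t. u1 (t + 2 * real_of_int k * pi)))" if "m1 \<le> m" for m
  proof -
    note m = m1[OF that]
    have Tm: "2 * pi \<le> T m" using m by (simp add: T_def)
    then have Tpos: "0 < T m" using pi_gt_zero by linarith
    interpret forced_dirichlet \<alpha> "T m powr (- (2 * \<alpha>))" c p "T m" L
      by standard (use assms c L m Tpos in \<open>auto simp: W_def mult.assoc\<close>)
    \<comment> \<open>The action has period \<open>2 * pi\<close>, not only \<open>T m\<close>;
      critical points distinct modulo \<open>2 * pi\<close> give solutions that no shift by a
      multiple of \<open>2 * pi\<close> identifies.\<close>
    obtain a b where ab: "a \<in> {0..<2 * pi}" "b \<in> {0..<2 * pi}" "a \<noteq> b"
      "((dsol a 0)\<^sup>2 - (dsol a 1)\<^sup>2) / (2 * T m) = 0" "((dsol b 0)\<^sup>2 - (dsol b 1)\<^sup>2) / (2 * T m) = 0"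
      using periodic_two_critical_points[OF action_has_derivative action_periodic[OF per.plus_1]]
        pi_gt_zero by auto
    have p_per: "p (t + T m) = p t" for t
      using per.plus_of_nat[of t m] by (simp add: T_def mult_ac)
    have arc: "arc \<alpha> (T m) \<tau> p (sol \<tau>) (dsol \<tau>)"
      if "((dsol \<tau> 0)\<^sup>2 - (dsol \<tau> 1)\<^sup>2) / (2 * T m) = 0" for \<tau>
    proof
      \<comment> \<open>Equal squares, with a nonnegative slope at 0 and a nonpositive one at 1,
        leave only opposite slopes.\<close>
      have "(dsol \<tau> 1)\<^sup>2 = (dsol \<tau> 0)\<^sup>2" using that Tpos by simp
      then show "dsol \<tau> 1 = - dsol \<tau> 0"
        using dsol_0_nonneg[of \<tau>] dsol_1_nonpos[of \<tau>] by (auto simp: power2_eq_iff)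
      show "(dsol \<tau> has_real_derivative T m powr (- (2 * \<alpha>)) * sol \<tau> x powr (-\<alpha>) + p (\<tau> + T m * x)) (at x)"
        if "x \<in> {0<..<1}" for x
        using dsol_has_derivative[OF that, of \<tau>] by (simp add: force_def)
    qed (rule Tpos cont p_per continuous_sol sol_0 sol_1 continuous_dsol sol_has_derivative
          above_barrier_pos[OF sol_above] | assumption)+
    interpret A: arc \<alpha> "T m" a p "sol a" "dsol a" by (rule arc[OF ab(4)])
    interpret B: arc \<alpha> "T m" b p "sol b" "dsol b" by (rule arc[OF ab(5)])
    have "B.bounce \<noteq> (\<lambda>t. A.bounce (t + 2 * real_of_int k * pi))" for k :: int
    proof
      assume eq: "B.bounce = (\<lambda>t. A.bounce (t + 2 * real_of_int k * pi))"
      have "b \<in> zero_set B.bounce" unfolding B.zero_set_bounce by (rule range_eqI[of _ _ 0]) simp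
      then have "b + 2 * real_of_int k * pi \<in> zero_set A.bounce"
        by (simp add: zero_set_def eq)
      then obtain j :: int where "b + 2 * real_of_int k * pi = a + j * T m"
        unfolding A.zero_set_bounce by auto
      \<comment> \<open>\<open>T m\<close> is a multiple of \<open>2 * pi\<close>, so such a shift
        would make \<open>a\<close> and \<open>b\<close> congruent modulo \<open>2 * pi\<close>,
        although they are distinct points of one period.\<close>
      then have eq: "b - a = of_int (j * int m - k) * (2 * pi)" by (simp add: T_def algebra_simps)
      have "\<bar>b - a\<bar> < 2 * pi" using ab(1,2) by auto
      then have "\<bar>of_int (j * int m - k) :: real\<bar> * (2 * pi) < 1 * (2 * pi)"
        unfolding eq by (simp only: abs_mult) simp
      then have "\<bar>of_int (j * int m - k) :: real\<bar> < 1"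
        by (rule mult_right_less_imp_less) simp
      then have "j * int m - k = 0" by linarith
      then have "b = a" using eq by simp
      then show False using ab(3) by simp
    qed
    \<comment> \<open>Since \<open>2 * pi \<le> T m\<close>, both \<open>a\<close> and
      \<open>b\<close> lie in the interval where impacts are counted.\<close>
    then show ?thesis
      using A.bouncing_solution_bounce B.bouncing_solution_bounce A.bounce_add_period
        B.bounce_add_period A.card_impacts B.card_impacts ab(1,2) Tm
      by (intro exI[of _ A.bounce] exI[of _ B.bounce]) auto
  qed
  then show ?thesis unfolding T_def by blast
qed

end
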